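(* Let $\lambda$ be a (countably additive, finite) signed Borel measure on $(\mathcal{P}_2(\mathbb{R}),W_2)$ satisfying $$\lambda(\mathcal{P}_2(\mathbb{R}))=1\qquad\text{and}\qquad\int_{\mathcal{P}_2(\mathbb{R})}m_2^2(\nu)\,\mathrm{d}|\lambda|(\nu)<\infty.$$ Then there exists a unique solution $\bar\mu\in\mathcal{P}_2(\mathbb{R})$ of $$\inf_{\mu\in\mathcal{P}_2(\mathbb{R})}\int_{\mathcal{P}_2(\mathbb{R})}W_2^2(\mu,\nu)\,\mathrm{d}\lambda(\nu),$$ and it is characterized by $$X_{\bar\mu}=P_{\mathcal{K}}\left(\int_{\mathcal{P}_2(\mathbb{R})}X_\nu\,\mathrm{d}\lambda(\nu)\right),$$ where $X_\nu\in\mathcal{K}$ is the pseudo-inverse of the distribution function of $\nu$.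
   Context: $\mathcal{P}_2(\mathbb{R})$ is the set of Borel probability measures $\mu$ on $\mathbb{R}$ with $m_2^2(\mu):=\int_{\mathbb{R}}|x|^2\,\mathrm{d}\mu(x)<\infty$, endowed with the 2-Wasserstein distance $W_2$ (quadratic cost). For a signed measure $\lambda$, $\lambda=\lambda^+-\lambda^-$ is its Hahn-Jordan decomposition, $|\lambda|=\lambda^++\lambda^-$, and integrals against $\lambda$ are differences of the integrals against $\lambda^+$ and $\lambda^-$. For $\mu\in\mathcal{P}_2(\mathbb{R})$, $F_\mu(x):=\mu((-\infty,x])$ for $x\in\mathbb{R}$ and $X_\mu(w):=\inf\{x:F_\mu(x)>w\}$ for $w\in(0,1)$. $\mathcal{K}\subset L^2(0,1)$ is the closed convex cone of (essentially) nondecreasing functions, and $P_{\mathcal{K}}:L^2(0,1)\to\mathcal{K}$ is the orthogonal projection onto $\mathcal{K}$. The integral $\int X_\nu\,\mathrm{d}\lambda(\nu)$ is the $L^2(0,1)$-valued (Bochner) integral of the map $\nu\mapsto X_\nu$. *)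

theory Defs
  imports "HOL-Probability.Probability"
begin

section \<open>Signed measures\<close>

text \<open>
  A finite signed measure is a real-valued set function; only its values on \<^term>\<open>sets M\<close> matter,
  and \<^term>\<open>M\<close> itself serves only as the carrier of the sigma-algebra.
\<close>

definition signed_measure :: "'a measure \<Rightarrow> ('a set \<Rightarrow> real) \<Rightarrow> bool" where
  "signed_measure M \<Lambda> \<longleftrightarrow>
     \<Lambda> {} = 0 \<and>
     (\<forall>A :: nat \<Rightarrow> 'a set. range A \<subseteq> sets M \<longrightarrow> disjoint_family A \<longrightarrow>
        (\<lambda>n. \<Lambda> (A n)) sums \<Lambda> (\<Union>n. A n))"

lemma signed_measure_sums:
  assumes "signed_measure M \<Lambda>" "range A \<subseteq> sets M" "disjoint_family A"
  shows "(\<lambda>n. \<Lambda> (A n)) sums \<Lambda> (\<Union>n. A n)"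
  using assms unfolding signed_measure_def by blast

lemma signed_measure_Un:
  assumes L: "signed_measure M \<Lambda>" and "A \<in> sets M" "B \<in> sets M" "A \<inter> B = {}"
  shows "\<Lambda> (A \<union> B) = \<Lambda> A + \<Lambda> B"
proof -
  have "(\<lambda>n. \<Lambda> (binaryset A B n)) sums \<Lambda> (\<Union>n. binaryset A B n)"
    using assms by (intro signed_measure_sums[OF L])
      (auto simp: disjoint_family_on_def binaryset_def)
  moreover have "(\<lambda>n. \<Lambda> (binaryset A B n)) sums (\<Lambda> A + \<Lambda> B)"
    by (rule binaryset_sums) (use L in \<open>simp add: signed_measure_def\<close>)
  ultimately show ?thesis
    by (simp add: sums_iff UN_binaryset_eq)
qed

lemma signed_measure_Diff:
  assumes L: "signed_measure M \<Lambda>" and "A \<in> sets M" "B \<in> sets M" "B \<subseteq> A"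
  shows "\<Lambda> (A - B) = \<Lambda> A - \<Lambda> B"
proof -
  have "\<Lambda> ((A - B) \<union> B) = \<Lambda> (A - B) + \<Lambda> B"
    using assms by (intro signed_measure_Un[OF L]) auto
  moreover have "(A - B) \<union> B = A" using assms by auto
  ultimately show ?thesis by simp
qed

lemma signed_measure_uminus:
  "signed_measure M \<Lambda> \<Longrightarrow> signed_measure M (\<lambda>A. - \<Lambda> A)"
  unfolding signed_measure_def by (auto intro: sums_minus)

lemma signed_measure_greedy:
  assumes L: "signed_measure M \<Lambda>" and D: "D \<in> sets M"
  shows "\<exists>B\<in>sets M. B \<subseteq> D \<and> 0 \<le> \<Lambda> B \<and>
           (1 \<le> \<Lambda> B \<or> (\<forall>C\<in>sets M. C \<subseteq> D \<longrightarrow> \<Lambda> C \<le> 2 * \<Lambda> B))"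
proof (cases "\<exists>B\<in>sets M. B \<subseteq> D \<and> 1 \<le> \<Lambda> B")
  case True
  then obtain B where "B \<in> sets M" "B \<subseteq> D" "1 \<le> \<Lambda> B" by blast
  then show ?thesis by (intro bexI[of _ B]) auto
next
  case False
  define S where "S = \<Lambda> ` {C\<in>sets M. C \<subseteq> D}"
  have bdd: "bdd_above S"
    using False unfolding S_def by (intro bdd_aboveI[of _ 1]) (auto simp: not_le less_imp_le)
  have zero: "0 \<in> S"
    using L unfolding S_def signed_measure_def by (auto intro!: image_eqI[of _ _ "{}"])
  have up: "c \<le> Sup S" if "c \<in> S" for c
    using bdd that by (rule cSup_upper[rotated])
  show ?thesis
  proof (cases "Sup S = 0")
    case True
    then show ?thesis
      using L up by (intro bexI[of _ "{}"]) (auto simp: S_def signed_measure_def)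
  next
    case False
    then have pos: "0 < Sup S" using up[OF zero] by simp
    then have "Sup S / 2 < Sup S" by simp
    then obtain x where "x \<in> S" "Sup S / 2 < x"
      using zero bdd by (metis empty_iff less_cSup_iff)
    then obtain B where "B \<in> sets M" "B \<subseteq> D" "Sup S / 2 < \<Lambda> B"
      unfolding S_def by auto
    moreover have "\<Lambda> C \<le> 2 * \<Lambda> B" if "C \<in> sets M" "C \<subseteq> D" for C
      using that up[of "\<Lambda> C"] \<open>Sup S / 2 < \<Lambda> B\<close> by (auto simp: S_def)
    ultimately show ?thesis
      using pos by (intro bexI[of _ B]) auto
  qed
qed

lemma signed_measure_negative_subset:
  assumes L: "signed_measure M \<Lambda>" and D: "D \<in> sets M"
  shows "\<exists>A\<in>sets M. A \<subseteq> D \<and> \<Lambda> A \<le> \<Lambda> D \<and> (\<forall>C\<in>sets M. C \<subseteq> A \<longrightarrow> \<Lambda> C \<le> 0)"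
proof -
  obtain b where b: "\<And>D. D \<in> sets M \<Longrightarrow> b D \<in> sets M \<and> b D \<subseteq> D \<and> 0 \<le> \<Lambda> (b D) \<and>
           (1 \<le> \<Lambda> (b D) \<or> (\<forall>C\<in>sets M. C \<subseteq> D \<longrightarrow> \<Lambda> C \<le> 2 * \<Lambda> (b D)))"
    using signed_measure_greedy[OF L] by metis
  define E where "E = rec_nat D (\<lambda>_ A. A - b A)"
  have E_Suc: "E (Suc n) = E n - b (E n)" for n by (simp add: E_def)
  have E_sets: "E n \<in> sets M" for n
    by (induction n) (use D b in \<open>auto simp: E_def\<close>)
  have b_sets: "b (E n) \<in> sets M" and b_sub: "b (E n) \<subseteq> E n" and b_nn: "0 \<le> \<Lambda> (b (E n))" for n
    using b[OF E_sets] by auto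
  have dec: "decseq E" by (rule decseq_SucI) (auto simp: E_Suc)
  have E_eq: "E n = D - (\<Union>i<n. b (E i))" for n
  proof (induction n)
    case (Suc n)
    then show ?case unfolding E_Suc by (auto simp: lessThan_Suc)
  qed (simp add: E_def)
  have disj: "disjoint_family (\<lambda>n. b (E n))"
  proof -
    have "b (E m) \<inter> b (E n) = {}" if "m < n" for m n
      using b_sub[of n] that by (auto simp: E_eq[of n])
    then show ?thesis
      unfolding disjoint_family_on_def by (metis inf_commute linorder_neqE_nat)
  qed
  define U where "U = (\<Union>n. b (E n))"
  have U_sets: "U \<in> sets M" using b_sets by (auto simp: U_def)
  have U_sub: "U \<subseteq> D" using b_sub E_eq unfolding U_def by blast
  have sums: "(\<lambda>n. \<Lambda> (b (E n))) sums \<Lambda> U"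
    unfolding U_def using b_sets disj by (intro signed_measure_sums[OF L]) auto
  have lim: "(\<lambda>n. \<Lambda> (b (E n))) \<longlonglongrightarrow> 0"
    using sums by (intro summable_LIMSEQ_zero) (auto simp: sums_iff)
  have "0 \<le> \<Lambda> U" using b_nn by (intro sums_le[OF _ sums_zero sums])
  then have 1: "\<Lambda> (D - U) \<le> \<Lambda> D"
    using signed_measure_Diff[OF L D U_sets U_sub] by simp
  have 2: "\<Lambda> C \<le> 0" if C: "C \<in> sets M" "C \<subseteq> D - U" for C
  proof -
    have CE: "C \<subseteq> E n" for n using C(2) by (auto simp: U_def E_eq[of n])
    have "\<forall>\<^sub>F n in sequentially. \<Lambda> (b (E n)) < 1"
      using lim by (rule order_tendstoD) simp
    then have "\<forall>\<^sub>F n in sequentially. \<Lambda> C \<le> 2 * \<Lambda> (b (E n))"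
      by eventually_elim (use b[OF E_sets] C CE in \<open>meson not_le\<close>)
    moreover have "(\<lambda>n. 2 * \<Lambda> (b (E n))) \<longlonglongrightarrow> 2 * 0"
      using lim by (intro tendsto_intros)
    ultimately have "\<Lambda> C \<le> 2 * 0"
      by (intro tendsto_lowerbound[where F = sequentially]) auto
    then show ?thesis by simp
  qed
  show ?thesis
    using 1 2 D U_sets by (intro bexI[of _ "D - U"]) auto
qed

theorem signed_measure_Hahn:
  assumes L: "signed_measure M \<Lambda>"
  shows "\<exists>H\<in>sets M. (\<forall>A\<in>sets M. A \<subseteq> H \<longrightarrow> 0 \<le> \<Lambda> A) \<and>
           (\<forall>A\<in>sets M. A \<subseteq> space M - H \<longrightarrow> \<Lambda> A \<le> 0)"
proof -
  have "\<exists>A\<in>sets M. A \<subseteq> D \<and> \<Lambda> A \<le> 0 \<and> (\<forall>C\<in>sets M. C \<subseteq> A \<longrightarrow> \<Lambda> C \<le> 0) \<and>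
      (\<Lambda> A \<le> -1 \<or> (\<forall>C\<in>sets M. C \<subseteq> D \<longrightarrow> 2 * \<Lambda> A \<le> \<Lambda> C))" if D: "D \<in> sets M" for D
  proof -
    obtain B where B: "B \<in> sets M" "B \<subseteq> D" "\<Lambda> B \<le> 0"
        "\<Lambda> B \<le> -1 \<or> (\<forall>C\<in>sets M. C \<subseteq> D \<longrightarrow> 2 * \<Lambda> B \<le> \<Lambda> C)"
      using signed_measure_greedy[OF signed_measure_uminus[OF L] D] by force
    obtain A where "A \<in> sets M" "A \<subseteq> B" "\<Lambda> A \<le> \<Lambda> B" "\<forall>C\<in>sets M. C \<subseteq> A \<longrightarrow> \<Lambda> C \<le> 0"
      using signed_measure_negative_subset[OF L B(1)] by auto
    then show ?thesis using B by (intro bexI[of _ A]) force+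
  qed
  then obtain b where b: "\<And>D. D \<in> sets M \<Longrightarrow> b D \<in> sets M \<and> b D \<subseteq> D \<and> \<Lambda> (b D) \<le> 0 \<and>
      (\<forall>C\<in>sets M. C \<subseteq> b D \<longrightarrow> \<Lambda> C \<le> 0) \<and>
      (\<Lambda> (b D) \<le> -1 \<or> (\<forall>C\<in>sets M. C \<subseteq> D \<longrightarrow> 2 * \<Lambda> (b D) \<le> \<Lambda> C))"
    by metis
  define E where "E = rec_nat (space M) (\<lambda>_ A. A - b A)"
  have E_Suc: "E (Suc n) = E n - b (E n)" for n by (simp add: E_def)
  have E_sets: "E n \<in> sets M" for n
    by (induction n) (use b in \<open>auto simp: E_def\<close>)
  have b_sets: "b (E n) \<in> sets M" and b_sub: "b (E n) \<subseteq> E n" for n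
    using b[OF E_sets] by auto
  have E_eq: "E n = space M - (\<Union>i<n. b (E i))" for n
  proof (induction n)
    case (Suc n)
    then show ?case unfolding E_Suc by (auto simp: lessThan_Suc)
  qed (simp add: E_def)
  have disj: "disjoint_family (\<lambda>n. b (E n))"
  proof -
    have "b (E m) \<inter> b (E n) = {}" if "m < n" for m n
      using b_sub[of n] that by (auto simp: E_eq[of n])
    then show ?thesis
      unfolding disjoint_family_on_def by (metis inf_commute linorder_neqE_nat)
  qed
  define N where "N = (\<Union>n. b (E n))"
  have N_sets: "N \<in> sets M" using b_sets by (auto simp: N_def)
  have "(\<lambda>n. \<Lambda> (b (E n))) sums \<Lambda> N"
    unfolding N_def using b_sets disj by (intro signed_measure_sums[OF L]) auto
  then have lim: "(\<lambda>n. \<Lambda> (b (E n))) \<longlonglongrightarrow> 0"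
    by (intro summable_LIMSEQ_zero) (auto simp: sums_iff)
  have 1: "0 \<le> \<Lambda> C" if C: "C \<in> sets M" "C \<subseteq> space M - N" for C
  proof -
    have CE: "C \<subseteq> E n" for n using C(2) by (auto simp: N_def E_eq[of n])
    have "\<forall>\<^sub>F n in sequentially. - 1 < \<Lambda> (b (E n))"
      using lim by (rule order_tendstoD) simp
    then have "\<forall>\<^sub>F n in sequentially. 2 * \<Lambda> (b (E n)) \<le> \<Lambda> C"
      by eventually_elim (use b[OF E_sets] C CE in \<open>meson not_le\<close>)
    moreover have "(\<lambda>n. 2 * \<Lambda> (b (E n))) \<longlonglongrightarrow> 2 * 0"
      using lim by (intro tendsto_intros)
    ultimately have "2 * 0 \<le> \<Lambda> C"
      by (intro tendsto_upperbound[where F = sequentially]) auto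
    then show ?thesis by simp
  qed
  have 2: "\<Lambda> C \<le> 0" if C: "C \<in> sets M" "C \<subseteq> N" for C
  proof -
    have "(\<lambda>n. \<Lambda> (C \<inter> b (E n))) sums \<Lambda> (\<Union>n. C \<inter> b (E n))"
      using b_sets disj C by (intro signed_measure_sums[OF L])
        (auto simp: disjoint_family_on_def)
    moreover have "(\<Union>n. C \<inter> b (E n)) = C" using C by (auto simp: N_def)
    moreover have "\<Lambda> (C \<inter> b (E n)) \<le> 0" for n
      using b[OF E_sets[of n]] C by auto
    ultimately show ?thesis
      using sums_le[OF _ _ sums_zero, of "\<lambda>n. \<Lambda> (C \<inter> b (E n))" "\<Lambda> C"] by simp
  qed
  show ?thesis
    using 1 2 N_sets sets.sets_into_space[OF N_sets]
    by (intro bexI[of _ "space M - N"]) (auto simp: double_diff)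
qed

text \<open>
  A positive set of some Hahn decomposition; it exists by the theorem above, and the Jordan parts
  below do not depend on the choice.
\<close>

definition Hahn_set :: "'a measure \<Rightarrow> ('a set \<Rightarrow> real) \<Rightarrow> 'a set" where
  "Hahn_set M \<Lambda> = (SOME H. H \<in> sets M \<and>
     (\<forall>A\<in>sets M. A \<subseteq> H \<longrightarrow> 0 \<le> \<Lambda> A) \<and>
     (\<forall>A\<in>sets M. A \<subseteq> space M - H \<longrightarrow> \<Lambda> A \<le> 0))"

definition pos_measure :: "'a measure \<Rightarrow> ('a set \<Rightarrow> real) \<Rightarrow> 'a measure" where
  "pos_measure M \<Lambda> = measure_of (space M) (sets M) (\<lambda>A. ennreal (\<Lambda> (A \<inter> Hahn_set M \<Lambda>)))"

definition neg_measure :: "'a measure \<Rightarrow> ('a set \<Rightarrow> real) \<Rightarrow> 'a measure" where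
  "neg_measure M \<Lambda> = measure_of (space M) (sets M) (\<lambda>A. ennreal (- \<Lambda> (A - Hahn_set M \<Lambda>)))"

definition abs_measure :: "'a measure \<Rightarrow> ('a set \<Rightarrow> real) \<Rightarrow> 'a measure" where
  "abs_measure M \<Lambda> = measure_of (space M) (sets M)
     (\<lambda>A. emeasure (pos_measure M \<Lambda>) A + emeasure (neg_measure M \<Lambda>) A)"

lemma
  assumes L: "signed_measure M \<Lambda>"
  shows Hahn_set_sets: "Hahn_set M \<Lambda> \<in> sets M"
    and Hahn_set_nonneg: "A \<in> sets M \<Longrightarrow> A \<subseteq> Hahn_set M \<Lambda> \<Longrightarrow> 0 \<le> \<Lambda> A"
    and Hahn_set_nonpos: "A \<in> sets M \<Longrightarrow> A \<subseteq> space M - Hahn_set M \<Lambda> \<Longrightarrow> \<Lambda> A \<le> 0"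
  using someI_ex[OF signed_measure_Hahn[OF L, unfolded Bex_def]]
  unfolding Hahn_set_def[symmetric] by auto

lemma sets_signed_parts [simp, measurable_cong]:
  "sets (pos_measure M \<Lambda>) = sets M" "sets (neg_measure M \<Lambda>) = sets M"
  "sets (abs_measure M \<Lambda>) = sets M"
  by (simp_all add: pos_measure_def neg_measure_def abs_measure_def)

lemma space_signed_parts [simp]:
  "space (pos_measure M \<Lambda>) = space M" "space (neg_measure M \<Lambda>) = space M"
  "space (abs_measure M \<Lambda>) = space M"
  by (simp_all add: pos_measure_def neg_measure_def abs_measure_def)

lemma emeasure_pos_measure:
  assumes L: "signed_measure M \<Lambda>" and A: "A \<in> sets M"
  shows "emeasure (pos_measure M \<Lambda>) A = ennreal (\<Lambda> (A \<inter> Hahn_set M \<Lambda>))"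
  unfolding pos_measure_def
proof (rule emeasure_measure_of_sigma)
  note H = Hahn_set_sets[OF L] Hahn_set_nonneg[OF L]
  show "countably_additive (sets M) (\<lambda>A. ennreal (\<Lambda> (A \<inter> Hahn_set M \<Lambda>)))"
    unfolding countably_additive_def
  proof safe
    fix A :: "nat \<Rightarrow> 'a set" assume A: "range A \<subseteq> sets M" "disjoint_family A"
    have "(\<lambda>n. \<Lambda> (A n \<inter> Hahn_set M \<Lambda>)) sums \<Lambda> (\<Union>n. A n \<inter> Hahn_set M \<Lambda>)"
      using A H by (intro signed_measure_sums[OF L]) (auto simp: disjoint_family_on_def)
    moreover have "0 \<le> \<Lambda> (A n \<inter> Hahn_set M \<Lambda>)" for n using A H by auto
    ultimately show "(\<Sum>n. ennreal (\<Lambda> (A n \<inter> Hahn_set M \<Lambda>))) = ennreal (\<Lambda> (\<Union> (range A) \<inter> Hahn_set M \<Lambda>))"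
      by (intro suminf_ennreal_eq) auto
  qed
qed (use A L in \<open>auto simp: positive_def signed_measure_def sets.sigma_algebra_axioms\<close>)

lemma emeasure_neg_measure:
  assumes L: "signed_measure M \<Lambda>" and A: "A \<in> sets M"
  shows "emeasure (neg_measure M \<Lambda>) A = ennreal (- \<Lambda> (A - Hahn_set M \<Lambda>))"
  unfolding neg_measure_def
proof (rule emeasure_measure_of_sigma)
  note H = Hahn_set_sets[OF L] Hahn_set_nonpos[OF L]
  show "countably_additive (sets M) (\<lambda>A. ennreal (- \<Lambda> (A - Hahn_set M \<Lambda>)))"
    unfolding countably_additive_def
  proof safe
    fix A :: "nat \<Rightarrow> 'a set" assume A: "range A \<subseteq> sets M" "disjoint_family A"
    have "(\<lambda>n. - \<Lambda> (A n - Hahn_set M \<Lambda>)) sums - \<Lambda> (\<Union>n. A n - Hahn_set M \<Lambda>)"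
      using A H by (intro sums_minus signed_measure_sums[OF L]) (auto simp: disjoint_family_on_def)
    moreover have "0 \<le> - \<Lambda> (A n - Hahn_set M \<Lambda>)" for n
      using A H(1) H(2)[of "A n - Hahn_set M \<Lambda>"] sets.sets_into_space[of "A n" M] by auto
    ultimately show "(\<Sum>n. ennreal (- \<Lambda> (A n - Hahn_set M \<Lambda>))) = ennreal (- \<Lambda> (\<Union> (range A) - Hahn_set M \<Lambda>))"
      by (intro suminf_ennreal_eq) auto
  qed
qed (use A L in \<open>auto simp: positive_def signed_measure_def sets.sigma_algebra_axioms\<close>)

lemma emeasure_abs_measure:
  assumes A: "A \<in> sets M"
  shows "emeasure (abs_measure M \<Lambda>) A = emeasure (pos_measure M \<Lambda>) A + emeasure (neg_measure M \<Lambda>) A"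
  unfolding abs_measure_def
proof (rule emeasure_measure_of_sigma)
  show "countably_additive (sets M) (\<lambda>A. emeasure (pos_measure M \<Lambda>) A + emeasure (neg_measure M \<Lambda>) A)"
    unfolding countably_additive_def
    by (auto simp: suminf_add[symmetric] suminf_emeasure)
qed (use A in \<open>auto simp: positive_def sets.sigma_algebra_axioms\<close>)

lemma signed_measure_Jordan:
  assumes L: "signed_measure M \<Lambda>" and A: "A \<in> sets M"
  shows "\<Lambda> A = measure (pos_measure M \<Lambda>) A - measure (neg_measure M \<Lambda>) A"
proof -
  note H = Hahn_set_sets[OF L] Hahn_set_nonneg[OF L] Hahn_set_nonpos[OF L]
  have "0 \<le> \<Lambda> (A \<inter> Hahn_set M \<Lambda>)" "\<Lambda> (A - Hahn_set M \<Lambda>) \<le> 0"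
    using H(1) H(2)[of "A \<inter> Hahn_set M \<Lambda>"] H(3)[of "A - Hahn_set M \<Lambda>"]
      A sets.sets_into_space[OF A] by auto
  moreover have "\<Lambda> A = \<Lambda> (A \<inter> Hahn_set M \<Lambda>) + \<Lambda> (A - Hahn_set M \<Lambda>)"
    using signed_measure_Un[OF L, of "A \<inter> Hahn_set M \<Lambda>" "A - Hahn_set M \<Lambda>"] A H(1)
    by (simp add: Int_Diff_disjoint Int_Diff_Un)
  ultimately show ?thesis
    using A by (simp add: measure_def emeasure_pos_measure[OF L] emeasure_neg_measure[OF L])
qed

lemma finite_measure_signed_parts:
  assumes L: "signed_measure M \<Lambda>"
  shows "finite_measure (pos_measure M \<Lambda>)" "finite_measure (neg_measure M \<Lambda>)"
    "finite_measure (abs_measure M \<Lambda>)"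
  by (auto intro!: finite_measureI
      simp: emeasure_abs_measure emeasure_pos_measure[OF L] emeasure_neg_measure[OF L])

definition signed_integral ::
  "'a measure \<Rightarrow> ('a set \<Rightarrow> real) \<Rightarrow> ('a \<Rightarrow> 'b) \<Rightarrow> 'b::{banach, second_countable_topology}" where
  "signed_integral M \<Lambda> f = integral\<^sup>L (pos_measure M \<Lambda>) f - integral\<^sup>L (neg_measure M \<Lambda>) f"

section \<open>The Hilbert space of square-integrable functions on the unit interval\<close>

definition lborel01 :: "real measure" where
  "lborel01 = restrict_space lborel {0<..<1}"

definition sq_integrable :: "(real \<Rightarrow> real) \<Rightarrow> bool" where
  "sq_integrable f \<longleftrightarrow> f \<in> borel_measurable lborel01 \<and> integrable lborel01 (\<lambda>x. (f x)\<^sup>2)"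

lemma space_lborel01 [simp]: "space lborel01 = {0<..<1}"
  by (simp add: lborel01_def space_restrict_space)

lemma prob_space_lborel01: "prob_space lborel01"
  by (rule prob_spaceI) (simp add: lborel01_def emeasure_restrict_space space_restrict_space)

lemma integrable_const_lborel01 [simp]: "integrable lborel01 (\<lambda>x. c)" for c :: real
  by (rule finite_measure.integrable_const[OF prob_space.finite_measure[OF prob_space_lborel01]])

lemma borel_measurable_lborel01:
  "f \<in> borel_measurable borel \<Longrightarrow> f \<in> borel_measurable lborel01"
  unfolding lborel01_def by (intro measurable_restrict_space1) simp

lemma sq_integrable_measurable: "sq_integrable f \<Longrightarrow> f \<in> borel_measurable lborel01"
  by (simp add: sq_integrable_def)

lemma sq_integrable_mult:
  assumes "sq_integrable f" "sq_integrable g"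
  shows "integrable lborel01 (\<lambda>x. f x * g x)"
proof (rule Bochner_Integration.integrable_bound)
  show "integrable lborel01 (\<lambda>x. (f x)\<^sup>2 + (g x)\<^sup>2)"
    using assms by (simp add: sq_integrable_def)
  have "\<bar>a * b\<bar> \<le> a\<^sup>2 + b\<^sup>2" for a b :: real
  proof -
    have "2 * (\<bar>a\<bar> * \<bar>b\<bar>) \<le> a\<^sup>2 + b\<^sup>2"
      using zero_le_power2[of "\<bar>a\<bar> - \<bar>b\<bar>"] by (simp add: power2_diff)
    then show ?thesis
      using mult_nonneg_nonneg[of "\<bar>a\<bar>" "\<bar>b\<bar>"] unfolding abs_mult by linarith
  qed
  then show "AE x in lborel01. norm (f x * g x) \<le> norm ((f x)\<^sup>2 + (g x)\<^sup>2)"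
    by (simp add: abs_of_nonneg)
qed (use assms[THEN sq_integrable_measurable] in simp)

lemma sq_integrable_scale: "sq_integrable f \<Longrightarrow> sq_integrable (\<lambda>x. c * f x)"
  by (auto simp: sq_integrable_def power_mult_distrib intro: borel_measurable_times)

lemma sq_integrable_add:
  assumes f: "sq_integrable f" and g: "sq_integrable g"
  shows "sq_integrable (\<lambda>x. f x + g x)"
proof -
  have "integrable lborel01 (\<lambda>x. (f x)\<^sup>2 + (g x)\<^sup>2 + 2 * (f x * g x))"
    using f g sq_integrable_mult[OF f g] by (simp add: sq_integrable_def)
  then show ?thesis
    using f g by (auto simp: sq_integrable_def power2_sum mult.assoc intro: borel_measurable_add)
qed

lemma sq_integrable_diff:
  assumes f: "sq_integrable f" and g: "sq_integrable g"
  shows "sq_integrable (\<lambda>x. f x - g x)"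
  using sq_integrable_add[OF f sq_integrable_scale[OF g, of "-1"]] by (simp only: mult_minus1 add_uminus_conv_diff)

lemma sq_integrable_bound:
  assumes f: "f \<in> borel_measurable lborel01" and g: "sq_integrable g"
    and "AE x in lborel01. \<bar>f x\<bar> \<le> \<bar>g x\<bar>"
  shows "sq_integrable f"
  unfolding sq_integrable_def
proof
  have *: "\<bar>a\<bar> \<le> \<bar>b\<bar> \<Longrightarrow> norm (a\<^sup>2) \<le> norm (b\<^sup>2)" for a b :: real
    using abs_le_square_iff[of a b] by simp
  have "AE x in lborel01. norm ((f x)\<^sup>2) \<le> norm ((g x)\<^sup>2)"
    using assms(3) by eventually_elim (rule *)
  moreover have "integrable lborel01 (\<lambda>x. (g x)\<^sup>2)"
    using g by (simp add: sq_integrable_def)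
  moreover have "(\<lambda>x. (f x)\<^sup>2) \<in> borel_measurable lborel01"
    using f by (rule borel_measurable_power)
  ultimately show "integrable lborel01 (\<lambda>x. (f x)\<^sup>2)"
    by (metis Bochner_Integration.integrable_bound)
qed (rule f)

lemma sq_integrable_const: "sq_integrable (\<lambda>x. c)"
  by (simp add: sq_integrable_def)

text \<open>The Hilbert space \<open>L\<^sup>2(0,1)\<close> of square-integrable functions modulo equality almost everywhere.\<close>

quotient_type L2 = "real \<Rightarrow> real" / partial:
  "\<lambda>f g. sq_integrable f \<and> sq_integrable g \<and> (AE x in lborel01. f x = g x)"
  by (rule part_equivpI)
    (auto intro!: exI[of _ "\<lambda>x. 0"] sympI transpI sq_integrable_const elim: AE_mp)

instantiation L2 :: real_inner
begin

lift_definition zero_L2 :: L2 is "\<lambda>x. 0"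
  by (simp add: sq_integrable_const)

lift_definition plus_L2 :: "L2 \<Rightarrow> L2 \<Rightarrow> L2" is "\<lambda>f g x. f x + g x"
  by (auto intro: sq_integrable_add)

lift_definition uminus_L2 :: "L2 \<Rightarrow> L2" is "\<lambda>f x. - f x"
  using sq_integrable_scale[of _ "-1"] by auto

lift_definition minus_L2 :: "L2 \<Rightarrow> L2 \<Rightarrow> L2" is "\<lambda>f g x. f x - g x"
  by (auto intro: sq_integrable_diff)

lift_definition scaleR_L2 :: "real \<Rightarrow> L2 \<Rightarrow> L2" is "\<lambda>c f x. c * f x"
  by (auto intro: sq_integrable_scale)

lift_definition inner_L2 :: "L2 \<Rightarrow> L2 \<Rightarrow> real" is "\<lambda>f g. \<integral>x. f x * g x \<partial>lborel01"
proof -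
  fix f f' g g' :: "real \<Rightarrow> real"
  assume *: "sq_integrable f \<and> sq_integrable f' \<and> (AE x in lborel01. f x = f' x)"
    "sq_integrable g \<and> sq_integrable g' \<and> (AE x in lborel01. g x = g' x)"
  show "(\<integral>x. f x * g x \<partial>lborel01) = (\<integral>x. f' x * g' x \<partial>lborel01)"
  proof (rule integral_cong_AE)
    show "AE x in lborel01. f x * g x = f' x * g' x"
      using *[THEN conjunct2, THEN conjunct2] by eventually_elim simp
  qed (use * in \<open>auto simp: sq_integrable_def\<close>)
qed

definition norm_L2 :: "L2 \<Rightarrow> real" where "norm_L2 u = sqrt (inner u u)"
definition dist_L2 :: "L2 \<Rightarrow> L2 \<Rightarrow> real" where "dist_L2 u v = norm (u - v)"
definition sgn_L2 :: "L2 \<Rightarrow> L2" where "sgn_L2 u = inverse (norm u) *\<^sub>R u"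
definition uniformity_L2 :: "(L2 \<times> L2) filter" where
  "uniformity_L2 = (INF e\<in>{0<..}. principal {(u, v). dist u v < e})"
definition open_L2 :: "L2 set \<Rightarrow> bool" where
  "open_L2 S \<longleftrightarrow> (\<forall>u\<in>S. \<forall>\<^sub>F (u', v) in uniformity. u' = u \<longrightarrow> v \<in> S)"

instance
proof
  fix u v w :: L2 and a b :: real
  show "u + v + w = u + (v + w)" by transfer (auto intro!: sq_integrable_add simp: add.assoc)
  show "u + v = v + u" by transfer (auto intro!: sq_integrable_add simp: add.commute)
  show "0 + u = u" by transfer auto
  show "- u + u = 0"
    by transfer (auto intro!: sq_integrable_const)
  show "u - v = u + - v"
    by transfer (use sq_integrable_diff in auto)
  show "a *\<^sub>R (u + v) = a *\<^sub>R u + a *\<^sub>R v"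
    by transfer (auto intro!: sq_integrable_scale sq_integrable_add simp: distrib_left)
  show "(a + b) *\<^sub>R u = a *\<^sub>R u + b *\<^sub>R u"
    by transfer (auto intro!: sq_integrable_scale sq_integrable_add simp: distrib_right)
  show "a *\<^sub>R b *\<^sub>R u = (a * b) *\<^sub>R u"
    by transfer (auto intro!: sq_integrable_scale simp: mult.assoc)
  show "1 *\<^sub>R u = u" by transfer auto
  show "dist u v = norm (u - v)" by (simp add: dist_L2_def)
  show "sgn u = inverse (norm u) *\<^sub>R u" by (simp add: sgn_L2_def)
  show "inner u v = inner v u" by transfer (simp add: mult.commute)
  show "inner (u + v) w = inner u w + inner v w"
    by transfer (simp add: distrib_right Bochner_Integration.integral_add sq_integrable_mult)
  show "inner (a *\<^sub>R u) v = a * inner u v"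
    by transfer (simp add: mult.assoc)
  show "0 \<le> inner u u"
    by transfer simp
  show "inner u u = 0 \<longleftrightarrow> u = 0"
  proof transfer
    fix f :: "real \<Rightarrow> real"
    assume f: "sq_integrable f \<and> sq_integrable f \<and> (AE x in lborel01. f x = f x)"
    have "(\<integral>x. f x * f x \<partial>lborel01) = 0 \<longleftrightarrow> (AE x in lborel01. f x * f x = 0)"
      using f sq_integrable_mult[of f f] by (intro integral_nonneg_eq_0_iff_AE) auto
    then show "(\<integral>x. f x * f x \<partial>lborel01) = 0 \<longleftrightarrow>
        sq_integrable f \<and> sq_integrable (\<lambda>x. 0) \<and> (AE x in lborel01. f x = 0)"
      using f sq_integrable_const[of 0] by simp
  qed
  show "norm u = sqrt (inner u u)" by (simp add: norm_L2_def)
qed (simp_all add: uniformity_L2_def open_L2_def)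

end

lemma L2_cases:
  obtains f where "sq_integrable f" "u = abs_L2 f"
  by (rule L2.abs_induct[of "\<lambda>u. \<exists>f. sq_integrable f \<and> u = abs_L2 f" u, THEN exE]) auto

lemma abs_L2_eq_iff:
  "sq_integrable f \<Longrightarrow> sq_integrable g \<Longrightarrow> abs_L2 f = abs_L2 g \<longleftrightarrow> (AE x in lborel01. f x = g x)"
  using Quotient_rel[OF Quotient_L2, of f g] by auto

lemma
  assumes "sq_integrable f" "sq_integrable g"
  shows abs_L2_add: "abs_L2 (\<lambda>x. f x + g x) = abs_L2 f + abs_L2 g"
    and abs_L2_diff: "abs_L2 (\<lambda>x. f x - g x) = abs_L2 f - abs_L2 g"
    and inner_abs_L2: "inner (abs_L2 f) (abs_L2 g) = (\<integral>x. f x * g x \<partial>lborel01)"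
  using assms by (simp_all add: plus_L2.abs_eq minus_L2.abs_eq inner_L2.abs_eq)

lemma abs_L2_scale: "sq_integrable f \<Longrightarrow> abs_L2 (\<lambda>x. c * f x) = c *\<^sub>R abs_L2 f"
  by (simp add: scaleR_L2.abs_eq)

lemma norm_abs_L2: "sq_integrable f \<Longrightarrow> norm (abs_L2 f) = sqrt (\<integral>x. (f x)\<^sup>2 \<partial>lborel01)"
  by (simp add: norm_eq_sqrt_inner inner_abs_L2 power2_eq_square)

lemma dist_abs_L2:
  "sq_integrable f \<Longrightarrow> sq_integrable g \<Longrightarrow>
     dist (abs_L2 f) (abs_L2 g) = sqrt (\<integral>x. (f x - g x)\<^sup>2 \<partial>lborel01)"
  by (simp add: dist_norm norm_abs_L2 sq_integrable_diff flip: abs_L2_diff)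

lemma abs_L2_tendsto:
  assumes s: "\<And>n. s n \<in> borel_measurable lborel01" and f: "f \<in> borel_measurable lborel01"
    and g: "sq_integrable g"
    and bound: "\<And>n. AE x in lborel01. \<bar>s n x\<bar> \<le> \<bar>g x\<bar>"
    and lim: "AE x in lborel01. (\<lambda>n. s n x) \<longlonglongrightarrow> f x"
  shows "sq_integrable f" "\<And>n. sq_integrable (s n)" "(\<lambda>n. abs_L2 (s n)) \<longlonglongrightarrow> abs_L2 f"
proof -
  have "AE x in lborel01. \<forall>n. \<bar>s n x\<bar> \<le> \<bar>g x\<bar>"
    using bound by (simp add: AE_all_countable)
  then have fb: "AE x in lborel01. \<bar>f x\<bar> \<le> \<bar>g x\<bar>"
    using lim
  proof eventually_elim
    fix x assume "\<forall>n. \<bar>s n x\<bar> \<le> \<bar>g x\<bar>" "(\<lambda>n. s n x) \<longlonglongrightarrow> f x"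
    then show "\<bar>f x\<bar> \<le> \<bar>g x\<bar>"
      by (intro tendsto_upperbound[OF tendsto_rabs, where F = sequentially]) auto
  qed
  show f': "sq_integrable f" using f g fb by (rule sq_integrable_bound)
  show s': "sq_integrable (s n)" for n using s g bound by (rule sq_integrable_bound)
  have "(\<lambda>n. \<integral>x. (s n x - f x)\<^sup>2 \<partial>lborel01) \<longlonglongrightarrow> (\<integral>x. 0 \<partial>lborel01)"
  proof (rule integral_dominated_convergence)
    show "(\<lambda>x. 0) \<in> borel_measurable lborel01" by simp
    show "(\<lambda>x. (s n x - f x)\<^sup>2) \<in> borel_measurable lborel01" for n
      using borel_measurable_diff[OF s f] by (rule borel_measurable_power)
    show "integrable lborel01 (\<lambda>x. 4 * (g x)\<^sup>2)"
      using g by (simp add: sq_integrable_def)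
    show "AE x in lborel01. (\<lambda>n. (s n x - f x)\<^sup>2) \<longlonglongrightarrow> 0"
      using lim
    proof eventually_elim
      fix x assume "(\<lambda>n. s n x) \<longlonglongrightarrow> f x"
      then have "(\<lambda>n. (s n x - f x)\<^sup>2) \<longlonglongrightarrow> (f x - f x)\<^sup>2"
        by (intro tendsto_intros)
      then show "(\<lambda>n. (s n x - f x)\<^sup>2) \<longlonglongrightarrow> 0" by simp
    qed
    show "AE x in lborel01. norm ((s n x - f x)\<^sup>2) \<le> 4 * (g x)\<^sup>2" for n
      using bound[of n] fb
    proof eventually_elim
      fix x assume "\<bar>s n x\<bar> \<le> \<bar>g x\<bar>" "\<bar>f x\<bar> \<le> \<bar>g x\<bar>"
      then have "\<bar>s n x - f x\<bar> \<le> \<bar>2 * g x\<bar>" by linarith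
      then have "(s n x - f x)\<^sup>2 \<le> (2 * g x)\<^sup>2" by (rule abs_le_square_iff[THEN iffD1])
      then show "norm ((s n x - f x)\<^sup>2) \<le> 4 * (g x)\<^sup>2" by (simp add: power_mult_distrib)
    qed
  qed
  then have "(\<lambda>n. sqrt (\<integral>x. (s n x - f x)\<^sup>2 \<partial>lborel01)) \<longlonglongrightarrow> sqrt 0"
    by (intro tendsto_real_sqrt) simp
  then have "(\<lambda>n. dist (abs_L2 (s n)) (abs_L2 f)) \<longlonglongrightarrow> 0"
    by (simp add: dist_abs_L2 f' s')
  then show "(\<lambda>n. abs_L2 (s n)) \<longlonglongrightarrow> abs_L2 f"
    by (rule tendsto_dist_iff[THEN iffD2])
qed

lemma norm_abs_L2_nn:
  assumes f: "sq_integrable f"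
  shows "(\<integral>\<^sup>+x. ennreal ((f x)\<^sup>2) \<partial>lborel01) = ennreal ((norm (abs_L2 f))\<^sup>2)"
  using f by (subst nn_integral_eq_integral) (simp_all add: sq_integrable_def norm_abs_L2)

lemma nn_integral_le_norm_abs_L2:
  assumes f: "sq_integrable f"
  shows "(\<integral>\<^sup>+x. ennreal \<bar>f x\<bar> \<partial>lborel01) \<le> ennreal (norm (abs_L2 f))"
proof -
  have af: "sq_integrable (\<lambda>x. \<bar>f x\<bar>)"
    by (rule sq_integrable_bound[OF _ f]) (use f in \<open>auto simp: sq_integrable_def\<close>)
  have i: "integrable lborel01 (\<lambda>x. \<bar>f x\<bar>)"
    using sq_integrable_mult[OF af sq_integrable_const[of 1]] by simp
  have "(\<integral>x. \<bar>f x\<bar> \<partial>lborel01) = inner (abs_L2 (\<lambda>x. \<bar>f x\<bar>)) (abs_L2 (\<lambda>x. 1))"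
    by (simp add: inner_abs_L2 af sq_integrable_const)
  also have "\<dots> \<le> norm (abs_L2 (\<lambda>x. \<bar>f x\<bar>)) * norm (abs_L2 (\<lambda>x. 1))"
    by (rule norm_cauchy_schwarz)
  also have "\<dots> = norm (abs_L2 f)"
    using prob_space.prob_space[OF prob_space_lborel01]
    by (simp add: norm_abs_L2 f af sq_integrable_const)
  finally show ?thesis
    using i by (subst nn_integral_eq_integral) (auto intro: ennreal_leI)
qed

instance L2 :: banach
proof
  fix X :: "nat \<Rightarrow> L2" assume X: "Cauchy X"
  have "\<exists>N. \<forall>m\<ge>N. \<forall>n\<ge>N. dist (X m) (X n) < (1/2)^k" for k :: nat
    using X by (intro metric_CauchyD) auto
  then obtain N where N: "\<And>k m n. N k \<le> m \<Longrightarrow> N k \<le> n \<Longrightarrow> dist (X m) (X n) < (1/2)^k"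
    by metis
  define r where "r k = (\<Sum>i\<le>k. N i) + k" for k
  have r_mono: "strict_mono r" by (rule strict_monoI_Suc) (simp add: r_def)
  have r_ge: "N k \<le> r m" if "k \<le> m" for k m
    using member_le_sum[of k "{..m}" N] that by (simp add: r_def)
  have "\<exists>f. sq_integrable f \<and> X (r k) = abs_L2 f" for k by (metis L2_cases)
  then obtain f where f: "\<And>k. sq_integrable (f k)" and Xf: "\<And>k. X (r k) = abs_L2 (f k)"
    by metis
  have fm: "f k \<in> borel_measurable lborel01" for k using f by (rule sq_integrable_measurable)
  have d: "norm (abs_L2 (\<lambda>x. f m x - f n x)) \<le> (1/2)^k" if "k \<le> m" "k \<le> n" for k m n
    using N[OF r_ge[OF that(1)] r_ge[OF that(2)]] by (simp add: Xf abs_L2_diff f dist_norm)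
  have "(\<integral>\<^sup>+x. (\<Sum>k. ennreal \<bar>f (Suc k) x - f k x\<bar>) \<partial>lborel01) =
      (\<Sum>k. \<integral>\<^sup>+x. ennreal \<bar>f (Suc k) x - f k x\<bar> \<partial>lborel01)"
    using fm by (intro nn_integral_suminf) measurable
  also have "\<dots> \<le> (\<Sum>k. ennreal ((1/2)^k))"
    by (intro suminf_le order_trans[OF nn_integral_le_norm_abs_L2] ennreal_leI d sq_integrable_diff f) auto
  also have "\<dots> = ennreal (\<Sum>k. (1/2)^k)"
    by (intro suminf_ennreal2) (auto intro: summable_geometric)
  also have "\<dots> < \<infinity>" by simp
  finally have "AE x in lborel01. (\<Sum>k. ennreal \<bar>f (Suc k) x - f k x\<bar>) \<noteq> \<infinity>"
    using fm by (intro nn_integral_PInf_AE) (measurable, auto)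
  then have conv: "AE x in lborel01. convergent (\<lambda>k. f k x)"
  proof eventually_elim
    fix x assume *: "(\<Sum>k. ennreal \<bar>f (Suc k) x - f k x\<bar>) \<noteq> \<infinity>"
    have "summable (\<lambda>k. \<bar>f (Suc k) x - f k x\<bar>)"
      using * by (intro summable_suminf_not_top) auto
    then have "summable (\<lambda>k. f (Suc k) x - f k x)" by (rule summable_rabs_cancel)
    then have "convergent (\<lambda>n. \<Sum>k<n. f (Suc k) x - f k x)" by (simp add: summable_iff_convergent)
    then have "convergent (\<lambda>n. f n x - f 0 x)" 
      by (simp only: sum_lessThan_telescope[of "\<lambda>k. f k x"])
    from convergent_add[OF this convergent_const[of "f 0 x"]]
    show "convergent (\<lambda>k. f k x)" by simp
  qed
  define g where "g x = lim (\<lambda>k. f k x)" for x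
  have gm: "g \<in> borel_measurable lborel01"
    unfolding g_def by (rule borel_measurable_lim_metric) (rule fm)
  have lim: "AE x in lborel01. (\<lambda>k. f k x) \<longlonglongrightarrow> g x"
    using conv by eventually_elim (simp add: g_def convergent_LIMSEQ_iff)
  have bd: "(\<integral>\<^sup>+x. ennreal ((f k x - g x)\<^sup>2) \<partial>lborel01) \<le> ennreal (((1/2)^k)\<^sup>2)" for k
  proof -
    have "(\<integral>\<^sup>+x. ennreal ((f k x - g x)\<^sup>2) \<partial>lborel01) =
        (\<integral>\<^sup>+x. liminf (\<lambda>m. ennreal ((f k x - f m x)\<^sup>2)) \<partial>lborel01)"
    proof (rule nn_integral_cong_AE)
      show "AE x in lborel01. ennreal ((f k x - g x)\<^sup>2) = liminf (\<lambda>m. ennreal ((f k x - f m x)\<^sup>2))"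
        using lim
      proof eventually_elim
        fix x assume "(\<lambda>k. f k x) \<longlonglongrightarrow> g x"
        then have "(\<lambda>m. ennreal ((f k x - f m x)\<^sup>2)) \<longlonglongrightarrow> ennreal ((f k x - g x)\<^sup>2)"
          by (intro tendsto_ennrealI tendsto_intros)
        then show "ennreal ((f k x - g x)\<^sup>2) = liminf (\<lambda>m. ennreal ((f k x - f m x)\<^sup>2))"
          by (intro lim_imp_Liminf[symmetric]) auto
      qed
    qed
    also have "\<dots> \<le> liminf (\<lambda>m. \<integral>\<^sup>+x. ennreal ((f k x - f m x)\<^sup>2) \<partial>lborel01)"
      using fm by (intro nn_integral_liminf) measurable
    also have "\<dots> \<le> liminf (\<lambda>m. ennreal (((1/2)^k)\<^sup>2))"
    proof (rule Liminf_mono)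
      show "\<forall>\<^sub>F m in sequentially. (\<integral>\<^sup>+x. ennreal ((f k x - f m x)\<^sup>2) \<partial>lborel01) \<le> ennreal (((1/2)^k)\<^sup>2)"
        using eventually_ge_at_top[of k]
      proof eventually_elim
        fix m assume "k \<le> m"
        then have "(norm (abs_L2 (\<lambda>x. f k x - f m x)))\<^sup>2 \<le> ((1/2)^k)\<^sup>2"
          by (intro power_mono d) auto
        then show "(\<integral>\<^sup>+x. ennreal ((f k x - f m x)\<^sup>2) \<partial>lborel01) \<le> ennreal (((1/2)^k)\<^sup>2)"
          by (subst norm_abs_L2_nn[OF sq_integrable_diff[OF f f]]) (rule ennreal_leI)
      qed
    qed
    also have "\<dots> = ennreal (((1/2)^k)\<^sup>2)" by (simp add: Liminf_const)
    finally show ?thesis .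
  qed
  have diff: "sq_integrable (\<lambda>x. f k x - g x)" for k
    unfolding sq_integrable_def
  proof
    show m: "(\<lambda>x. f k x - g x) \<in> borel_measurable lborel01"
      using fm gm by (rule borel_measurable_diff)
    have "(\<integral>\<^sup>+x. ennreal ((f k x - g x)\<^sup>2) \<partial>lborel01) < \<infinity>"
      by (rule order.strict_trans1[OF bd]) simp
    then show "integrable lborel01 (\<lambda>x. (f k x - g x)\<^sup>2)"
      using borel_measurable_power[OF m] by (intro integrableI_nonneg) auto
  qed
  have g: "sq_integrable g"
    using sq_integrable_diff[OF f[of 0] diff[of 0]] by simp
  have dist: "dist (X (r k)) (abs_L2 g) \<le> (1/2)^k" for k
  proof -
    have "(norm (abs_L2 (\<lambda>x. f k x - g x)))\<^sup>2 \<le> ((1/2)^k)\<^sup>2"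
      using bd[of k] by (simp only: norm_abs_L2_nn[OF diff] ennreal_le_iff zero_le_power2)
    then have "norm (abs_L2 (\<lambda>x. f k x - g x)) \<le> (1/2)^k"
      by (rule power2_le_imp_le) simp
    then show ?thesis by (simp add: Xf dist_norm abs_L2_diff f g)
  qed
  have "(\<lambda>k. dist (X (r k)) (abs_L2 g)) \<longlonglongrightarrow> 0"
  proof (rule tendsto_sandwich[of "\<lambda>_. 0"])
    show "(\<lambda>k. (1/2 :: real)^k) \<longlonglongrightarrow> 0" by (rule LIMSEQ_power_zero) simp
  qed (use dist in auto)
  then have sub: "(\<lambda>k. X (r k)) \<longlonglongrightarrow> abs_L2 g" by (rule tendsto_dist_iff[THEN iffD2])
  show "convergent X"
  proof (rule convergentI, rule metric_LIMSEQ_I)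
    fix e :: real assume "0 < e"
    then obtain M where M: "\<And>m n. M \<le> m \<Longrightarrow> M \<le> n \<Longrightarrow> dist (X m) (X n) < e / 2"
      using metric_CauchyD[OF X half_gt_zero[OF \<open>0 < e\<close>]] by blast
    obtain K where K: "\<And>k. K \<le> k \<Longrightarrow> dist (X (r k)) (abs_L2 g) < e / 2"
      using metric_LIMSEQ_D[OF sub half_gt_zero[OF \<open>0 < e\<close>]] by blast
    have "dist (X n) (abs_L2 g) < e" if "M \<le> n" for n
    proof -
      let ?k = "max M K"
      have "M \<le> r ?k" using seq_suble[OF r_mono, of ?k] by simp
      then have "dist (X n) (X (r ?k)) < e / 2" using M that by simp
      moreover have "dist (X (r ?k)) (abs_L2 g) < e / 2" using K by simp
      ultimately show ?thesis
        using dist_triangle[of "X n" "abs_L2 g" "X (r ?k)"] by simp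
    qed
    then show "\<exists>n0. \<forall>n\<ge>n0. dist (X n) (abs_L2 g) < e" by blast
  qed
qed

lemma sq_integrable_indicator:
  "A \<in> sets borel \<Longrightarrow> sq_integrable (indicator A)"
  by (rule sq_integrable_bound[OF borel_measurable_lborel01[OF borel_measurable_indicator] sq_integrable_const[of 1]])
    (auto simp: indicator_def)

lemma L2_closed_subspace_UNIV:
  fixes S :: "L2 set"
  assumes closed: "closed S"
    and add: "\<And>u v. u \<in> S \<Longrightarrow> v \<in> S \<Longrightarrow> u + v \<in> S"
    and scale: "\<And>c u. u \<in> S \<Longrightarrow> c *\<^sub>R u \<in> S"
    and basic: "\<And>a. a \<in> \<rat> \<Longrightarrow> abs_L2 (indicator {..a}) \<in> S"
  shows "S = UNIV"
proof -
  have ind_meas: "indicator A \<in> borel_measurable lborel01" if "A \<in> sets borel" for A :: "real set"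
    using that by (intro borel_measurable_lborel01 borel_measurable_indicator)
  have lim: "abs_L2 f \<in> S"
    if "\<And>n. s n \<in> borel_measurable lborel01" "f \<in> borel_measurable lborel01" "sq_integrable g"
      "\<And>n. AE x in lborel01. \<bar>s n x\<bar> \<le> \<bar>g x\<bar>" "AE x in lborel01. (\<lambda>n. s n x) \<longlonglongrightarrow> f x"
      "\<And>n. abs_L2 (s n) \<in> S" for s f g
    by (rule closed_sequentially[OF closed _ abs_L2_tendsto(3)[OF that(1-5)]]) (use that(6) in auto)
  have atMost: "abs_L2 (indicator {..a}) \<in> S" for a
  proof -
    have "a \<in> closure \<rat>" by (simp add: Rats_closure_real)
    then obtain q where q: "\<And>n. q n \<in> \<rat>" "q \<longlonglongrightarrow> a" by (auto simp: closure_sequential)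
    show ?thesis
    proof (rule lim[of "\<lambda>n. indicator {..q n}" _ "\<lambda>_. 1"])
      have "AE x in lborel. x \<noteq> a" by (rule AE_lborel_singleton)
      then have "AE x in lborel01. x \<noteq> a"
        unfolding lborel01_def by (subst AE_restrict_space_iff) (auto elim: eventually_mono)
      then show "AE x in lborel01. (\<lambda>n. indicator {..q n} x :: real) \<longlonglongrightarrow> indicator {..a} x"
      proof eventually_elim
        fix x :: real assume "x \<noteq> a"
        then consider "x < a" | "a < x" by linarith
        then have "\<forall>\<^sub>F n in sequentially. indicator {..q n} x = (indicator {..a} x :: real)"
        proof cases
          case 1
          from order_tendstoD(1)[OF q(2) 1] show ?thesis
            by eventually_elim (use 1 in \<open>simp add: indicator_def\<close>)
        next
          case 2
          from order_tendstoD(2)[OF q(2) 2] show ?thesis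
            by eventually_elim (use 2 in \<open>simp add: indicator_def\<close>)
        qed
        then show "(\<lambda>n. indicator {..q n} x :: real) \<longlonglongrightarrow> indicator {..a} x"
          by (rule tendsto_eventually)
      qed
    qed (auto intro!: ind_meas sq_integrable_const basic q simp: indicator_def)
  qed
  have zero: "abs_L2 (\<lambda>x. 0) \<in> S"
    using scale[OF atMost, of 0 0] by (simp add: zero_L2_def)
  moreover have "indicator {} = (\<lambda>x::real. 0::real)" by (intro ext) simp
  ultimately have empty_mem: "abs_L2 (indicator {}) \<in> S" by simp
  have ind: "abs_L2 (indicator A) \<in> S" if A: "A \<in> sets borel" for A
  proof -
    have borel: "sigma_sets UNIV (range (\<lambda>a::real. {..a})) = sets borel"
      by (simp add: borel_eq_atMost)
    have "Int_stable (range (\<lambda>a::real. {..a}))"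
      by (auto simp: Int_stable_def)
    moreover have "range (\<lambda>a::real. {..a}) \<subseteq> Pow UNIV" by simp
    moreover have "A \<in> sigma_sets UNIV (range (\<lambda>a::real. {..a}))"
      using A by (simp only: borel)
    ultimately show ?thesis
    proof (induction A rule: sigma_sets_induct_disjoint)
      case (basic A)
      then show ?case using atMost by auto
    next
      case empty
      show ?case by (rule empty_mem)
    next
      case (compl A)
      then have A: "A \<in> sets borel" by (simp add: borel)
      have "sq_integrable (indicator (UNIV - A))"
        "sq_integrable (\<lambda>x. indicator {..1} x + (-1) * indicator A x)"
        using A by (intro sq_integrable_add sq_integrable_scale sq_integrable_indicator; simp)+
      then have "abs_L2 (indicator (UNIV - A)) =
          abs_L2 (\<lambda>x. indicator {..1} x + (-1) * indicator A x)"
        by (subst abs_L2_eq_iff) (auto intro!: AE_I2 simp: indicator_def)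
      also have "\<dots> = abs_L2 (indicator {..1}) + (-1) *\<^sub>R abs_L2 (indicator A)"
        by (simp only: abs_L2_add abs_L2_scale sq_integrable_indicator sq_integrable_scale A atMost_borel)
      finally show ?case using add[OF atMost[of 1] scale[OF compl.IH, of "-1"]] by (simp only:)
    next
      case (union A)
      then have A: "A n \<in> sets borel" for n by (auto simp: borel)
      have fin: "abs_L2 (indicator (\<Union>i<n. A i)) \<in> S" for n
      proof (induction n)
        case 0
        show ?case using zero by simp
      next
        case (Suc n)
        have "(\<Union>i<n. A i) \<inter> A n = {}"
          using union(1) unfolding disjoint_family_on_def by (auto, metis IntI empty_iff less_irrefl)
        then have "indicator (\<Union>i<Suc n. A i) =
            (\<lambda>x. indicator (\<Union>i<n. A i) x + indicator (A n) x :: real)"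
          by (intro ext) (auto simp: lessThan_Suc indicator_def)
        moreover have "(\<Union>i<n. A i) \<in> sets borel" using A by auto
        ultimately show ?case
          using add[OF Suc.IH union(3)[of n]] by (simp add: abs_L2_add sq_integrable_indicator A)
      qed
      show ?case
      proof (rule lim[of "\<lambda>n. indicator (\<Union>i<n. A i)" _ "\<lambda>_. 1"])
        show "AE x in lborel01. (\<lambda>n. indicator (\<Union>i<n. A i) x :: real) \<longlonglongrightarrow> indicator (\<Union>i. A i) x"
          by (intro AE_I2 LIMSEQ_indicator_UN)
        show "indicator (\<Union>i<n. A i) \<in> borel_measurable lborel01" for n
          using A by (intro ind_meas) auto
        show "indicator (\<Union>i. A i) \<in> borel_measurable lborel01"
          using A by (intro ind_meas) auto
      qed (use fin in \<open>auto intro!: sq_integrable_const simp: indicator_def\<close>)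
    qed
  qed
  have sum: "sq_integrable (\<lambda>x. \<Sum>i\<in>I. h i x) \<and> abs_L2 (\<lambda>x. \<Sum>i\<in>I. h i x) \<in> S"
    if "finite I" "\<And>i. i \<in> I \<Longrightarrow> sq_integrable (h i) \<and> abs_L2 (h i) \<in> S"
    for I :: "real set" and h
    using that
  proof (induction I rule: finite_induct)
    case empty
    show ?case using zero by (simp add: sq_integrable_const)
  next
    case (insert i I)
    then show ?case
      using add[of "abs_L2 (h i)" "abs_L2 (\<lambda>x. \<Sum>i\<in>I. h i x)"]
      by (simp add: abs_L2_add sq_integrable_add)
  qed
  have "u \<in> S" for u
  proof -
    obtain f where f: "sq_integrable f" and u: "u = abs_L2 f" by (rule L2_cases)
    obtain s where s: "\<And>i. simple_function lborel01 (s i)"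
      and s_lim: "\<And>x. x \<in> space lborel01 \<Longrightarrow> (\<lambda>i. s i x) \<longlonglongrightarrow> f x"
      and s_bound: "\<And>i x. x \<in> space lborel01 \<Longrightarrow> dist (s i x) 0 \<le> 2 * dist (f x) 0"
      using borel_measurable_implies_sequence_metric[OF sq_integrable_measurable[OF f], of 0] by metis
    have sm: "s i \<in> borel_measurable lborel01" for i
      using s by (rule borel_measurable_simple_function)
    have "abs_L2 (s i) \<in> S" for i
    proof -
      define T where "T y = s i -` {y} \<inter> {0<..<1}" for y
      have T: "T y \<in> sets borel" for y
      proof -
        have "s i -` {y} \<inter> space lborel01 \<in> sets lborel01"
          using sm by (rule measurable_sets) simp
        then show ?thesis
          by (simp add: T_def lborel01_def sets_restrict_space_iff)
      qed
      have *: "sq_integrable (\<lambda>x. y * indicator (T y) x)" "abs_L2 (\<lambda>x. y * indicator (T y) x) \<in> S" for y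
        using scale[OF ind[OF T]] by (simp_all add: abs_L2_scale sq_integrable_scale sq_integrable_indicator T)
      have fin: "finite (s i ` {0<..<1})" using simple_functionD(1)[OF s[of i]] by simp
      let ?t = "\<lambda>x. \<Sum>y\<in>s i ` {0<..<1}. y * indicator (T y) x"
      have t: "sq_integrable ?t" "abs_L2 ?t \<in> S"
        using sum[OF fin, of "\<lambda>y x. y * indicator (T y) x"] * by blast+
      have rep: "s i x = ?t x" if "x \<in> {0<..<1}" for x
      proof -
        have "x \<in> space lborel01" using that by simp
        note simple_function_indicator_representation_banach[OF s[of i] this]
        also have "(\<Sum>y\<in>s i ` space lborel01. indicator (s i -` {y} \<inter> space lborel01) x *\<^sub>R y) = ?t x"
          unfolding T_def space_lborel01 real_scaleR_def by (intro sum.cong refl mult.commute)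
        finally show ?thesis .
      qed
      have st: "AE x in lborel01. s i x = ?t x"
        by (rule AE_I2, rule rep) simp
      have "sq_integrable (s i)"
        using s_bound by (intro sq_integrable_bound[OF sm sq_integrable_scale[OF f, of 2]] AE_I2) (simp add: abs_mult)
      then have "abs_L2 (s i) = abs_L2 ?t"
        using st t(1) abs_L2_eq_iff by blast
      then show ?thesis using t(2) by (simp only:)
    qed
    moreover have "AE x in lborel01. \<bar>s i x\<bar> \<le> \<bar>2 * f x\<bar>" for i
      using s_bound by (intro AE_I2) (simp add: abs_mult)
    ultimately show ?thesis
      unfolding u using s_lim
      by (intro lim[of s f "\<lambda>x. 2 * f x"])
        (auto intro!: sm AE_I2 sq_integrable_scale f sq_integrable_measurable)
  qed
  then show ?thesis by auto
qed

lemma L2_countable_dense: "\<exists>D :: L2 set. countable D \<and> closure D = UNIV"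
proof -
  define comb :: "(rat \<times> rat) list \<Rightarrow> L2" where
    "comb xs = (\<Sum>(q, a)\<leftarrow>xs. of_rat q *\<^sub>R abs_L2 (indicator {..of_rat a}))" for xs
  define D where "D = range comb"
  have comb_append: "comb (xs @ ys) = comb xs + comb ys" for xs ys
    by (simp add: comb_def)
  have comb_scale: "of_rat q *\<^sub>R comb xs = comb (map (\<lambda>(p, a). (q * p, a)) xs)" for q xs
    by (induction xs) (auto simp: comb_def scaleR_add_right of_rat_mult)
  have "closure D = UNIV"
  proof (rule L2_closed_subspace_UNIV)
    show "closed (closure D)" by simp
    show "u + v \<in> closure D" if uv: "u \<in> closure D" "v \<in> closure D" for u v
    proof -
      obtain s t where s: "\<And>n. s n \<in> D" "s \<longlonglongrightarrow> u" and t: "\<And>n. t n \<in> D" "t \<longlonglongrightarrow> v"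
        using uv unfolding closure_sequential by blast
      have "s n + t n \<in> D" for n
        using s(1)[of n] t(1)[of n] by (auto simp: D_def comb_append[symmetric])
      then show ?thesis
        using tendsto_add[OF s(2) t(2)] unfolding closure_sequential
        by (intro exI[of _ "\<lambda>n. s n + t n"]) simp
    qed
    show "c *\<^sub>R u \<in> closure D" if u: "u \<in> closure D" for c u
    proof -
      obtain s where s: "\<And>n. s n \<in> D" "s \<longlonglongrightarrow> u"
        using u unfolding closure_sequential by blast
      have "c \<in> closure \<rat>" by (simp add: Rats_closure_real)
      then obtain q where q: "\<And>n. q n \<in> \<rat>" "q \<longlonglongrightarrow> c" unfolding closure_sequential by blast
      have "q n *\<^sub>R s n \<in> D" for n
        using s(1)[of n] q(1)[of n] by (auto simp: D_def comb_scale elim!: Rats_cases)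
      then show ?thesis
        using tendsto_scaleR[OF q(2) s(2)] unfolding closure_sequential
        by (intro exI[of _ "\<lambda>n. q n *\<^sub>R s n"]) simp
    qed
    show "abs_L2 (indicator {..a}) \<in> closure D" if "a \<in> \<rat>" for a
    proof -
      obtain b where "a = of_rat b" using \<open>a \<in> \<rat>\<close> by (rule Rats_cases)
      then have "abs_L2 (indicator {..a}) = comb [(1, b)]" by (simp add: comb_def)
      then show ?thesis using closure_subset[of D] by (auto simp: D_def)
    qed
  qed
  moreover have "countable D" by (simp add: D_def)
  ultimately show ?thesis by blast
qed

instance L2 :: second_countable_topology
proof
  obtain D :: "L2 set" where D: "countable D" "closure D = UNIV"
    using L2_countable_dense by blast
  define B where "B = (\<lambda>(d, n). ball d (1 / real (Suc n))) ` (D \<times> (UNIV :: nat set))"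
  have "topological_basis B"
  proof (rule topological_basisI)
    show "open U" if "U \<in> B" for U using that by (auto simp: B_def)
    fix U :: "L2 set" and x assume "open U" "x \<in> U"
    then obtain e where e: "0 < e" "ball x e \<subseteq> U" by (meson open_contains_ball)
    obtain n where n: "1 / real (Suc n) < e / 2"
      using e(1) by (metis half_gt_zero inverse_eq_divide reals_Archimedean)
    have "x \<in> closure D" by (simp add: D)
    then obtain d where d: "d \<in> D" "dist d x < 1 / real (Suc n)"
      unfolding closure_approachable by (meson of_nat_0_less_iff zero_less_Suc zero_less_divide_1_iff)
    have "ball d (1 / real (Suc n)) \<subseteq> ball x e"
    proof
      fix y assume "y \<in> ball d (1 / real (Suc n))"
      then show "y \<in> ball x e"
        using d(2) n dist_triangle[of x y d] by (simp add: dist_commute)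
    qed
    then show "\<exists>V\<in>B. x \<in> V \<and> V \<subseteq> U"
      using d e(2) by (intro bexI[of _ "ball d (1 / real (Suc n))"]) (auto simp: B_def)
  qed
  moreover have "countable B" using D(1) by (simp add: B_def)
  ultimately show "\<exists>B :: L2 set set. countable B \<and> open = generate_topology B"
    by (intro exI[of _ B]) (simp add: topological_basis_imp_subbasis)
qed

section \<open>The Wasserstein space over the real line\<close>

text \<open>Classes of essentially nondecreasing functions: those with a representative nondecreasing on \<open>(0,1)\<close>.\<close>

definition mono_cone :: "L2 set" where
  "mono_cone = {abs_L2 f | f. sq_integrable f \<and> mono_on {0<..<1} f}"

text \<open>
  The orthogonal projection onto a closed convex set is the unique nearest point. The constant
  \<^const>\<open>closest_point\<close> is not available here: it is restricted to the class
  \<^class>\<open>heine_borel\<close>, which excludes infinite-dimensional spaces.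
\<close>

definition metric_projection :: "'a::metric_space set \<Rightarrow> 'a \<Rightarrow> 'a" where
  "metric_projection S x = (THE y. y \<in> S \<and> (\<forall>z\<in>S. dist x y \<le> dist x z))"

text \<open>A \<^const>\<open>real_distribution\<close> is a probability measure on the Borel sets of the real line.\<close>

definition P2 :: "real measure set" where
  "P2 = {\<mu>. real_distribution \<mu> \<and> integrable \<mu> (\<lambda>x. x\<^sup>2)}"

definition second_moment :: "real measure \<Rightarrow> real" where
  "second_moment \<mu> = (\<integral>x. x\<^sup>2 \<partial>\<mu>)"

definition couplings :: "real measure \<Rightarrow> real measure \<Rightarrow> (real \<times> real) measure set" where
  "couplings \<mu> \<nu> = {\<gamma>. prob_space \<gamma> \<and> sets \<gamma> = sets (borel \<Otimes>\<^sub>M borel) \<and>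
     distr \<gamma> borel fst = \<mu> \<and> distr \<gamma> borel snd = \<nu>}"

definition W2 :: "real measure \<Rightarrow> real measure \<Rightarrow> real" where
  "W2 \<mu> \<nu> = sqrt (enn2real (INF \<gamma>\<in>couplings \<mu> \<nu>. \<integral>\<^sup>+z. ennreal ((fst z - snd z)\<^sup>2) \<partial>\<gamma>))"

text \<open>The Borel sigma-algebra of the metric space \<^term>\<open>(P2, W2)\<close>, generated by its open sets.\<close>

definition borel_P2 :: "real measure measure" where
  "borel_P2 = sigma P2 {U. Metric_space.mopen P2 W2 U}"

definition quantile :: "real measure \<Rightarrow> real \<Rightarrow> real" where
  "quantile \<mu> w = Inf {x. w < cdf \<mu> x}"

definition W2_functional :: "(real measure set \<Rightarrow> real) \<Rightarrow> real measure \<Rightarrow> real" where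
  "W2_functional \<Lambda> \<mu> = signed_integral borel_P2 \<Lambda> (\<lambda>\<nu>. (W2 \<mu> \<nu>)\<^sup>2)"

definition quantile_L2 :: "real measure \<Rightarrow> L2" where
  "quantile_L2 \<mu> = abs_L2 (quantile \<mu>)"

context real_distribution
begin

lemma quantile_set:
  assumes "0 < w" "w < 1"
  shows "{x. w < cdf M x} \<noteq> {}" "bdd_below {x. w < cdf M x}"
proof -
  have "\<forall>\<^sub>F x in at_top. w < cdf M x"
    using cdf_lim_at_top_prob assms(2) by (rule order_tendstoD)
  then show "{x. w < cdf M x} \<noteq> {}"
    using eventually_happens by fastforce
  have "\<forall>\<^sub>F x in at_bot. cdf M x < w"
    using cdf_lim_at_bot assms(1) by (rule order_tendstoD)
  then obtain b where b: "\<And>x. x \<le> b \<Longrightarrow> cdf M x < w"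
    by (auto simp: eventually_at_bot_linorder)
  have "b \<le> x" if "w < cdf M x" for x
    using b[of x] that by (cases "x \<le> b") auto
  then show "bdd_below {x. w < cdf M x}" by (intro bdd_belowI[of _ b]) simp
qed

lemma quantile_le: "0 < w \<Longrightarrow> w < cdf M x \<Longrightarrow> quantile M w \<le> x"
  unfolding quantile_def
  using quantile_set[of w] cdf_bounded_prob[of x] by (intro cInf_lower) auto

lemma le_cdf_quantile:
  assumes w: "0 < w" "w < 1" and x: "quantile M w \<le> x"
  shows "w \<le> cdf M x"
proof (rule tendsto_lowerbound[of "cdf M" _ "at_right x"])
  show "(cdf M \<longlongrightarrow> cdf M x) (at_right x)"
    using cdf_is_right_cont[of x] by (simp add: continuous_within)
  have "w \<le> cdf M y" if "x < y" for y
  proof -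
    have "quantile M w < y" using x that by simp
    then obtain z where "w < cdf M z" "z < y"
      unfolding quantile_def using cInf_less_iff[OF quantile_set[OF w]] by auto
    then show ?thesis using cdf_nondecreasing[of z y] by simp
  qed
  then show "\<forall>\<^sub>F y in at_right x. w \<le> cdf M y"
    by (auto simp: eventually_at_filter)
qed simp

lemma mono_on_quantile: "mono_on {0<..<1} (quantile M)"
proof (rule mono_onI)
  fix v w :: real assume *: "v \<in> {0<..<1}" "w \<in> {0<..<1}" "v \<le> w"
  then show "quantile M v \<le> quantile M w"
    unfolding quantile_def
    using quantile_set[of v] quantile_set[of w] by (intro cInf_superset_mono) auto
qed

lemma quantile_measurable: "quantile M \<in> borel_measurable lborel01"
  using borel_measurable_mono_on_fnc[OF mono_on_quantile]
  by (simp add: lborel01_def cong: measurable_cong_sets)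

lemma distr_quantile: "distr lborel01 borel (quantile M) = M"
proof (rule cdf_unique)
  let ?D = "distr lborel01 borel (quantile M)"
  interpret U: prob_space lborel01 by (rule prob_space_lborel01)
  interpret D: real_distribution ?D
    using U.prob_space_distr[OF quantile_measurable]
    by (auto simp: real_distribution_def real_distribution_axioms_def)
  show "real_distribution M" "real_distribution ?D" by unfold_locales
  show "cdf ?D = cdf M"
  proof
    fix x
    have bd: "0 \<le> cdf M x" "cdf M x \<le> 1"
      using cdf_nonneg cdf_bounded_prob by auto
    have pre: "quantile M -` {..x} \<inter> {0<..<1} \<in> sets lborel01"
      using measurable_sets[OF quantile_measurable, of "{..x}"] by simp
    have Ioo: "{0<..<cdf M x} \<in> sets lborel01"
      using bd by (auto simp: lborel01_def sets_restrict_space_iff)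
    have "AE w in lborel. w \<noteq> cdf M x" by (rule AE_lborel_singleton)
    then have "AE w in lborel01. w \<noteq> cdf M x"
      unfolding lborel01_def by (subst AE_restrict_space_iff) (auto elim: eventually_mono)
    then have "AE w in lborel01. w \<in> quantile M -` {..x} \<inter> {0<..<1} \<longleftrightarrow> w \<in> {0<..<cdf M x}"
      using AE_space
    proof eventually_elim
      fix w assume w: "w \<noteq> cdf M x" "w \<in> space lborel01"
      then show "w \<in> quantile M -` {..x} \<inter> {0<..<1} \<longleftrightarrow> w \<in> {0<..<cdf M x}"
        using quantile_le[of w x] le_cdf_quantile[of w x] by auto
    qed
    then have "measure lborel01 (quantile M -` {..x} \<inter> {0<..<1}) = measure lborel01 {0<..<cdf M x}"
      using pre Ioo by (intro measure_eq_AE)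
    also have "\<dots> = cdf M x"
      using bd by (subst lborel01_def, subst measure_restrict_space) auto
    finally show "cdf ?D x = cdf M x"
      by (simp add: cdf_def measure_distr quantile_measurable)
  qed
qed

end

lemma P2_real_distribution: "\<mu> \<in> P2 \<Longrightarrow> real_distribution \<mu>"
  by (simp add: P2_def)

lemma sq_integrable_quantile:
  assumes "\<mu> \<in> P2"
  shows "sq_integrable (quantile \<mu>)"
proof -
  interpret real_distribution \<mu> using assms by (rule P2_real_distribution)
  have "integrable (distr lborel01 borel (quantile \<mu>)) (\<lambda>x. x\<^sup>2)"
    using assms unfolding distr_quantile P2_def by simp
  then show ?thesis
    using quantile_measurable by (simp add: sq_integrable_def integrable_distr_eq)
qed

lemma quantile_L2_in_mono_cone: "\<mu> \<in> P2 \<Longrightarrow> quantile_L2 \<mu> \<in> mono_cone"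
  unfolding quantile_L2_def using sq_integrable_quantile real_distribution.mono_on_quantile[OF P2_real_distribution]
  unfolding mono_cone_def by blast

end

theory Submission
  imports Defs
begin

text \<open>
  On the line the monotone coupling is optimal, so \<open>\<nu> \<mapsto> X\<^sub>\<nu>\<close> is an isometry of the Wasserstein space onto
  the closed convex cone of nondecreasing functions in \<open>L\<^sup>2(0,1)\<close>. Put \<open>B = \<integral> X\<^sub>\<nu> d\<lambda>(\<nu>)\<close>. Since \<open>\<lambda>\<close>
  has total mass one, expanding the square turns the functional into \<open>\<parallel>X\<^sub>\<mu> - B\<parallel>\<^sup>2\<close> plus a constant, even
  though \<open>\<lambda>\<close> is signed. Minimisers are therefore the measures whose quantile function is the point of the cone
  nearest to \<open>B\<close>. Optimality of the monotone coupling follows by writing the positive part of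
  \<open>y - x\<close>, squared, as twice the area of the triangle \<open>x \<le> s \<le> t < y\<close>: integrating, the cost depends
  on a coupling only through the masses of the sets \<open>{x \<le> s, t < y}\<close> and \<open>{y \<le> s, t < x}\<close>, each of which
  the monotone coupling makes as small as the marginals allow.
\<close>

section \<open>Optimality of the monotone coupling\<close>

lemma nn_integral_triangle:
  fixes x y :: real
  shows "(\<integral>\<^sup>+t. \<integral>\<^sup>+s. ennreal (2 * of_bool (x \<le> s \<and> s \<le> t \<and> t < y)) \<partial>lborel \<partial>lborel) =
    ennreal ((max 0 (y - x))\<^sup>2)"
proof -
  have two: "2 * ennreal r = ennreal (2 * r)" for r
    by (simp add: ennreal_mult')
  have inner: "(\<integral>\<^sup>+s. ennreal (2 * of_bool (x \<le> s \<and> s \<le> t \<and> t < y)) \<partial>lborel) =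
      ennreal (2 * (t - x)) * indicator {x..<y} t" for t
  proof -
    have "(\<integral>\<^sup>+s. ennreal (2 * of_bool (x \<le> s \<and> s \<le> t \<and> t < y)) \<partial>lborel) =
        (\<integral>\<^sup>+s. (2 * indicator {..<y} t) * indicator {x..t} s \<partial>lborel)"
      by (intro nn_integral_cong) (auto simp: indicator_def)
    also have "\<dots> = (2 * indicator {..<y} t) * emeasure lborel {x..t}"
      by (subst nn_integral_cmult_indicator) auto
    also have "\<dots> = ennreal (2 * (t - x)) * indicator {x..<y} t"
      by (auto simp: indicator_def two)
    finally show ?thesis .
  qed
  show ?thesis
  proof (cases "x \<le> y")
    case True
    have "(\<integral>\<^sup>+t. ennreal (2 * (t - x)) * indicator {x..<y} t \<partial>lborel) =
        (\<integral>\<^sup>+t. ennreal (2 * (t - x)) * indicator {x..y} t \<partial>lborel)"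
      using AE_lborel_singleton[of y] by (intro nn_integral_cong_AE) (auto simp: indicator_def)
    also have "\<dots> = ennreal ((y - x)\<^sup>2 - (x - x)\<^sup>2)"
      by (rule nn_integral_FTC_Icc[of "\<lambda>t. 2 * (t - x)" x y "\<lambda>t. (t - x)\<^sup>2"])
        (use True in \<open>auto intro!: derivative_eq_intros\<close>)
    finally show ?thesis using True by (simp add: inner)
  qed (simp add: inner)
qed

lemma nn_integral_pos_part_square:
  fixes f g :: "'a \<Rightarrow> real"
  assumes M: "sigma_finite_measure M"
    and [measurable]: "f \<in> borel_measurable M" "g \<in> borel_measurable M"
  shows "(\<integral>\<^sup>+w. ennreal ((max 0 (g w - f w))\<^sup>2) \<partial>M) =
    (\<integral>\<^sup>+t. \<integral>\<^sup>+s. ennreal 2 * (of_bool (s \<le> t) * emeasure M {w\<in>space M. f w \<le> s \<and> t < g w}) \<partial>lborel \<partial>lborel)"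
proof -
  interpret M: sigma_finite_measure M by (rule M)
  interpret pair_sigma_finite M "lborel :: real measure" ..
  define k where "k w s t = ennreal (2 * of_bool (f w \<le> s \<and> s \<le> t \<and> t < g w))" for w s t
  have "(\<integral>\<^sup>+w. ennreal ((max 0 (g w - f w))\<^sup>2) \<partial>M) = (\<integral>\<^sup>+w. \<integral>\<^sup>+t. \<integral>\<^sup>+s. k w s t \<partial>lborel \<partial>lborel \<partial>M)"
    by (simp add: nn_integral_triangle k_def)
  also have "\<dots> = (\<integral>\<^sup>+t. \<integral>\<^sup>+w. \<integral>\<^sup>+s. k w s t \<partial>lborel \<partial>M \<partial>lborel)"
    by (rule Fubini'[symmetric]) (unfold k_def, measurable)
  also have "\<dots> = (\<integral>\<^sup>+t. \<integral>\<^sup>+s. \<integral>\<^sup>+w. k w s t \<partial>M \<partial>lborel \<partial>lborel)"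
    by (intro nn_integral_cong Fubini'[symmetric]) (unfold k_def, measurable)
  also have "\<dots> = (\<integral>\<^sup>+t. \<integral>\<^sup>+s. ennreal 2 * (of_bool (s \<le> t) * emeasure M {w\<in>space M. f w \<le> s \<and> t < g w}) \<partial>lborel \<partial>lborel)"
  proof (intro nn_integral_cong)
    fix s t
    have "(\<integral>\<^sup>+w. k w s t \<partial>M) =
        (\<integral>\<^sup>+w. (ennreal 2 * of_bool (s \<le> t)) * indicator {w\<in>space M. f w \<le> s \<and> t < g w} w \<partial>M)"
      by (intro nn_integral_cong) (auto simp: k_def indicator_def)
    also have "\<dots> = (ennreal 2 * of_bool (s \<le> t)) * emeasure M {w\<in>space M. f w \<le> s \<and> t < g w}"
      by (rule nn_integral_cmult_indicator) measurable
    finally show "(\<integral>\<^sup>+w. k w s t \<partial>M) =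
        ennreal 2 * (of_bool (s \<le> t) * emeasure M {w\<in>space M. f w \<le> s \<and> t < g w})"
      by (simp add: mult.assoc)
  qed
  finally show ?thesis .
qed

lemma mono_on_lborel01_measurable:
  fixes f :: "real \<Rightarrow> real"
  assumes "mono_on {0<..<1} f"
  shows "f \<in> borel_measurable lborel01"
  using borel_measurable_mono_on_fnc[OF assms]
  by (simp add: lborel01_def cong: measurable_cong_sets)

text \<open>Sublevel sets of monotone functions are nested, so the left-hand side is the positive part of the
  difference of the two distribution functions.\<close>

lemma mono_rectangle_le:
  fixes f g :: "real \<Rightarrow> real" and F G :: "'a \<Rightarrow> real"
  assumes M: "prob_space M"
    and [measurable]: "F \<in> borel_measurable M" "G \<in> borel_measurable M"
    and f: "mono_on {0<..<1} f" and g: "mono_on {0<..<1} g"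
    and Ff: "distr M borel F = distr lborel01 borel f"
    and Gg: "distr M borel G = distr lborel01 borel g"
  shows "emeasure lborel01 {w\<in>space lborel01. f w \<le> s \<and> t < g w} \<le> emeasure M {w\<in>space M. F w \<le> s \<and> t < G w}"
proof -
  interpret M: prob_space M by (rule M)
  interpret U: prob_space lborel01 by (rule prob_space_lborel01)
  have [measurable]: "f \<in> borel_measurable lborel01" "g \<in> borel_measurable lborel01"
    using f g by (auto intro: mono_on_lborel01_measurable)
  define A B where "A = {w\<in>space lborel01. f w \<le> s}" and "B = {w\<in>space lborel01. g w \<le> t}"
  have [measurable]: "A \<in> sets lborel01" "B \<in> sets lborel01" unfolding A_def B_def by measurable
  have eq: "{w\<in>space lborel01. f w \<le> s \<and> t < g w} = A - B" by (auto simp: A_def B_def)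
  have A: "measure lborel01 A = measure M {w\<in>space M. F w \<le> s}"
    using arg_cong[OF Ff, of "\<lambda>N. measure N {..s}"]
    by (simp add: measure_distr A_def vimage_def Int_def conj_commute)
  have B: "measure lborel01 B = measure M {w\<in>space M. G w \<le> t}"
    using arg_cong[OF Gg, of "\<lambda>N. measure N {..t}"]
    by (simp add: measure_distr B_def vimage_def Int_def conj_commute)
  have "A \<subseteq> B \<or> B \<subseteq> A"
  proof (rule ccontr)
    assume "\<not> (A \<subseteq> B \<or> B \<subseteq> A)"
    then obtain a b where "a \<in> A" "a \<notin> B" "b \<in> B" "b \<notin> A" by blast
    then show False
      using mono_onD[OF f, of a b] mono_onD[OF f, of b a] mono_onD[OF g, of a b] mono_onD[OF g, of b a]
      by (cases "a \<le> b") (auto simp: A_def B_def)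
  qed
  then have "measure lborel01 (A - B) \<le> measure M {w\<in>space M. F w \<le> s \<and> t < G w}"
  proof
    assume "A \<subseteq> B"
    then have "A - B = {}" by auto
    then show ?thesis by (simp only: measure_empty measure_nonneg)
  next
    assume "B \<subseteq> A"
    then have "measure lborel01 (A - B) = measure lborel01 A - measure lborel01 B"
      by (intro U.finite_measure_Diff) auto
    moreover have "measure M {w\<in>space M. F w \<le> s} \<le>
        measure M ({w\<in>space M. F w \<le> s \<and> t < G w} \<union> {w\<in>space M. G w \<le> t})"
      by (intro M.finite_measure_mono) auto
    moreover have "\<dots> \<le> measure M {w\<in>space M. F w \<le> s \<and> t < G w} + measure M {w\<in>space M. G w \<le> t}"
      by (intro measure_Un_le) measurable
    ultimately show ?thesis by (simp add: A B)
  qed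
  then show ?thesis unfolding eq by (simp add: M.emeasure_eq_measure U.emeasure_eq_measure)
qed

lemma mono_coupling_le:
  fixes f g :: "real \<Rightarrow> real" and F G :: "'a \<Rightarrow> real"
  assumes M: "prob_space M"
    and m [measurable]: "F \<in> borel_measurable M" "G \<in> borel_measurable M"
    and f: "mono_on {0<..<1} f" and g: "mono_on {0<..<1} g"
    and Ff: "distr M borel F = distr lborel01 borel f"
    and Gg: "distr M borel G = distr lborel01 borel g"
  shows "(\<integral>\<^sup>+w. ennreal ((f w - g w)\<^sup>2) \<partial>lborel01) \<le> (\<integral>\<^sup>+w. ennreal ((F w - G w)\<^sup>2) \<partial>M)"
proof -
  interpret M: prob_space M by (rule M)
  interpret U: prob_space lborel01 by (rule prob_space_lborel01)
  have [measurable]: "f \<in> borel_measurable lborel01" "g \<in> borel_measurable lborel01"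
    using f g by (auto intro: mono_on_lborel01_measurable)
  have split: "ennreal ((x - y)\<^sup>2) = ennreal ((max 0 (y - x))\<^sup>2) + ennreal ((max 0 (x - y))\<^sup>2)" for x y :: real
    by (cases "x \<le> y") (auto simp: max_def power2_commute)
  show ?thesis
    unfolding split
    by (subst (1 2) nn_integral_add)
      (auto simp: nn_integral_pos_part_square U.sigma_finite_measure_axioms M.sigma_finite_measure_axioms
        simp del: space_lborel01
        intro!: add_mono nn_integral_mono mult_left_mono mono_rectangle_le[OF M] m f g Ff Gg)
qed

lemma mono_on_eq_AE:
  fixes f g :: "real \<Rightarrow> real"
  assumes f: "mono_on {0<..<1} f" and g: "mono_on {0<..<1} g"
    and "distr lborel01 borel f = distr lborel01 borel g"
  shows "AE x in lborel01. f x = g x"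
proof -
  have [measurable]: "f \<in> borel_measurable lborel01" "g \<in> borel_measurable lborel01"
    using f g by (auto intro: mono_on_lborel01_measurable)
  have "(\<integral>\<^sup>+w. ennreal ((f w - g w)\<^sup>2) \<partial>lborel01) \<le> (\<integral>\<^sup>+w. ennreal ((f w - f w)\<^sup>2) \<partial>lborel01)"
    by (intro mono_coupling_le prob_space_lborel01 f g) (use assms(3) in auto)
  then have "(\<integral>\<^sup>+w. ennreal ((f w - g w)\<^sup>2) \<partial>lborel01) = 0" by simp
  then have "AE w in lborel01. ennreal ((f w - g w)\<^sup>2) = 0"
    by (subst (asm) nn_integral_0_iff_AE) auto
  then show ?thesis by eventually_elim (auto simp: ennreal_eq_0_iff)
qed

section \<open>The Wasserstein space as a cone in the Hilbert space\<close>

lemma distr_quantile_P2: "\<mu> \<in> P2 \<Longrightarrow> distr lborel01 borel (quantile \<mu>) = \<mu>"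
  by (rule real_distribution.distr_quantile[OF P2_real_distribution])

lemma W2_eq_dist:
  assumes \<mu>: "\<mu> \<in> P2" and \<nu>: "\<nu> \<in> P2"
  shows "W2 \<mu> \<nu> = dist (quantile_L2 \<mu>) (quantile_L2 \<nu>)"
proof -
  note sq = sq_integrable_quantile[OF \<mu>] sq_integrable_quantile[OF \<nu>]
  have [measurable]: "quantile \<mu> \<in> borel_measurable lborel01" "quantile \<nu> \<in> borel_measurable lborel01"
    using sq by (auto intro: sq_integrable_measurable)
  interpret U: prob_space lborel01 by (rule prob_space_lborel01)
  define \<gamma>0 where "\<gamma>0 = distr lborel01 (borel \<Otimes>\<^sub>M borel) (\<lambda>w. (quantile \<mu> w, quantile \<nu> w))"
  have "(INF \<gamma>\<in>couplings \<mu> \<nu>. \<integral>\<^sup>+z. ennreal ((fst z - snd z)\<^sup>2) \<partial>\<gamma>) =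
      (\<integral>\<^sup>+w. ennreal ((quantile \<mu> w - quantile \<nu> w)\<^sup>2) \<partial>lborel01)"
  proof (rule antisym)
    have "\<gamma>0 \<in> couplings \<mu> \<nu>"
      by (auto simp: couplings_def \<gamma>0_def distr_distr comp_def distr_quantile_P2 \<mu> \<nu> intro!: U.prob_space_distr)
    moreover have "(\<integral>\<^sup>+z. ennreal ((fst z - snd z)\<^sup>2) \<partial>\<gamma>0) =
        (\<integral>\<^sup>+w. ennreal ((quantile \<mu> w - quantile \<nu> w)\<^sup>2) \<partial>lborel01)"
      by (simp add: \<gamma>0_def nn_integral_distr)
    ultimately show "(INF \<gamma>\<in>couplings \<mu> \<nu>. \<integral>\<^sup>+z. ennreal ((fst z - snd z)\<^sup>2) \<partial>\<gamma>) \<le>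
        (\<integral>\<^sup>+w. ennreal ((quantile \<mu> w - quantile \<nu> w)\<^sup>2) \<partial>lborel01)"
      by (intro INF_lower2[where i = \<gamma>0]) simp_all
  next
    show "(\<integral>\<^sup>+w. ennreal ((quantile \<mu> w - quantile \<nu> w)\<^sup>2) \<partial>lborel01) \<le>
        (INF \<gamma>\<in>couplings \<mu> \<nu>. \<integral>\<^sup>+z. ennreal ((fst z - snd z)\<^sup>2) \<partial>\<gamma>)"
    proof (rule INF_greatest)
      fix \<gamma> assume "\<gamma> \<in> couplings \<mu> \<nu>"
      then have \<gamma>: "prob_space \<gamma>" "distr \<gamma> borel fst = \<mu>" "distr \<gamma> borel snd = \<nu>"
        and [measurable_cong]: "sets \<gamma> = sets (borel \<Otimes>\<^sub>M borel)"
        by (auto simp: couplings_def)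
      show "(\<integral>\<^sup>+w. ennreal ((quantile \<mu> w - quantile \<nu> w)\<^sup>2) \<partial>lborel01) \<le>
          (\<integral>\<^sup>+z. ennreal ((fst z - snd z)\<^sup>2) \<partial>\<gamma>)"
        by (rule mono_coupling_le)
          (use \<gamma> \<mu> \<nu> in \<open>auto simp: distr_quantile_P2 intro!: real_distribution.mono_on_quantile P2_real_distribution\<close>)
    qed
  qed
  also have "\<dots> = ennreal ((norm (quantile_L2 \<mu> - quantile_L2 \<nu>))\<^sup>2)"
    unfolding quantile_L2_def abs_L2_diff[OF sq, symmetric] by (rule norm_abs_L2_nn[OF sq_integrable_diff[OF sq]])
  finally show ?thesis by (simp add: W2_def dist_norm)
qed

lemma quantile_L2_eq_iff:
  assumes \<mu>: "\<mu> \<in> P2" and \<nu>: "\<nu> \<in> P2"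
  shows "quantile_L2 \<mu> = quantile_L2 \<nu> \<longleftrightarrow> \<mu> = \<nu>"
proof
  note sq = sq_integrable_quantile[OF \<mu>] sq_integrable_quantile[OF \<nu>]
  assume "quantile_L2 \<mu> = quantile_L2 \<nu>"
  then have "AE x in lborel01. quantile \<mu> x = quantile \<nu> x"
    by (simp add: quantile_L2_def abs_L2_eq_iff sq)
  then have "distr lborel01 borel (quantile \<mu>) = distr lborel01 borel (quantile \<nu>)"
    by (intro distr_cong_AE sq_integrable_measurable sq) auto
  then show "\<mu> = \<nu>" by (simp add: distr_quantile_P2 \<mu> \<nu>)
qed simp

lemma quantile_L2_image: "quantile_L2 ` P2 = mono_cone"
proof
  show "quantile_L2 ` P2 \<subseteq> mono_cone" using quantile_L2_in_mono_cone by blast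
  show "mono_cone \<subseteq> quantile_L2 ` P2"
  proof
    fix u assume "u \<in> mono_cone"
    then obtain f where f: "sq_integrable f" "mono_on {0<..<1} f" and u: "u = abs_L2 f"
      by (auto simp: mono_cone_def)
    note [measurable] = sq_integrable_measurable[OF f(1)]
    interpret U: prob_space lborel01 by (rule prob_space_lborel01)
    define \<mu> where "\<mu> = distr lborel01 borel f"
    have "real_distribution \<mu>"
      unfolding \<mu>_def by (intro real_distribution.intro U.prob_space_distr real_distribution_axioms.intro) auto
    moreover have "integrable \<mu> (\<lambda>x. x\<^sup>2)"
      using f(1) by (simp add: \<mu>_def integrable_distr_eq sq_integrable_def)
    ultimately have \<mu>: "\<mu> \<in> P2" by (simp add: P2_def)
    then have "AE x in lborel01. quantile \<mu> x = f x"
      by (intro mono_on_eq_AE real_distribution.mono_on_quantile P2_real_distribution f)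
        (simp_all add: distr_quantile_P2, simp add: \<mu>_def)
    then have "quantile_L2 \<mu> = u"
      by (simp add: u quantile_L2_def abs_L2_eq_iff sq_integrable_quantile \<mu> f)
    then show "u \<in> quantile_L2 ` P2" using \<mu> by blast
  qed
qed

lemma second_moment_eq_norm:
  assumes \<mu>: "\<mu> \<in> P2"
  shows "second_moment \<mu> = (norm (quantile_L2 \<mu>))\<^sup>2"
proof -
  note sq = sq_integrable_quantile[OF \<mu>]
  have "second_moment \<mu> = (\<integral>x. x\<^sup>2 \<partial>distr lborel01 borel (quantile \<mu>))"
    by (simp add: second_moment_def distr_quantile_P2 \<mu>)
  also have "\<dots> = (\<integral>x. (quantile \<mu> x)\<^sup>2 \<partial>lborel01)"
    using sq_integrable_measurable[OF sq] by (simp add: integral_distr)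
  finally show ?thesis by (simp add: quantile_L2_def norm_abs_L2 sq)
qed

lemma W2_commute: "W2 \<mu> \<nu> = W2 \<nu> \<mu>"
proof -
  have "(INF \<gamma>\<in>couplings \<mu> \<nu>. \<integral>\<^sup>+z. ennreal ((fst z - snd z)\<^sup>2) \<partial>\<gamma>) \<le>
      (INF \<gamma>\<in>couplings \<nu> \<mu>. \<integral>\<^sup>+z. ennreal ((fst z - snd z)\<^sup>2) \<partial>\<gamma>)" for \<mu> \<nu>
  proof (rule INF_greatest)
    fix \<gamma> assume "\<gamma> \<in> couplings \<nu> \<mu>"
    then have \<gamma>: "prob_space \<gamma>" "distr \<gamma> borel fst = \<nu>" "distr \<gamma> borel snd = \<mu>"
      and [measurable_cong]: "sets \<gamma> = sets (borel \<Otimes>\<^sub>M borel)"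
      by (auto simp: couplings_def)
    define \<gamma>' where "\<gamma>' = distr \<gamma> (borel \<Otimes>\<^sub>M borel) (\<lambda>z. (snd z, fst z))"
    have "\<gamma>' \<in> couplings \<mu> \<nu>"
      using \<gamma> by (auto simp: couplings_def \<gamma>'_def distr_distr comp_def intro!: prob_space.prob_space_distr)
    moreover have "(\<integral>\<^sup>+z. ennreal ((fst z - snd z)\<^sup>2) \<partial>\<gamma>') = (\<integral>\<^sup>+z. ennreal ((fst z - snd z)\<^sup>2) \<partial>\<gamma>)"
      by (simp add: \<gamma>'_def nn_integral_distr power2_commute)
    ultimately show "(INF \<gamma>\<in>couplings \<mu> \<nu>. \<integral>\<^sup>+z. ennreal ((fst z - snd z)\<^sup>2) \<partial>\<gamma>) \<le>
        (\<integral>\<^sup>+z. ennreal ((fst z - snd z)\<^sup>2) \<partial>\<gamma>)"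
      by (intro INF_lower2[where i = \<gamma>']) simp_all
  qed
  then show ?thesis by (auto simp: W2_def intro!: arg_cong[where f = enn2real] antisym)
qed

lemma Metric_space_P2: "Metric_space P2 W2"
proof
  have nonneg: "0 \<le> enn2real a" for a by simp
  show "0 \<le> W2 \<mu> \<nu>" for \<mu> \<nu> unfolding W2_def by (rule real_sqrt_ge_zero[OF nonneg])
  fix \<mu> \<nu> assume \<mu>: "\<mu> \<in> P2" and \<nu>: "\<nu> \<in> P2"
  then show "W2 \<mu> \<nu> = 0 \<longleftrightarrow> \<mu> = \<nu>" by (simp add: W2_eq_dist quantile_L2_eq_iff)
  show "W2 \<mu> \<rho> \<le> W2 \<mu> \<nu> + W2 \<nu> \<rho>" if "\<rho> \<in> P2" for \<rho>
    using \<mu> \<nu> that by (simp add: W2_eq_dist dist_triangle)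
next
  show "W2 \<mu> \<nu> = W2 \<nu> \<mu>" for \<mu> \<nu> by (rule W2_commute)
qed

lemma space_borel_P2 [simp]: "space borel_P2 = P2"
  unfolding borel_P2_def by (rule space_measure_of) (auto simp: Metric_space.mopen_def[OF Metric_space_P2])

lemma quantile_L2_measurable: "quantile_L2 \<in> borel_measurable borel_P2"
proof (rule borel_measurableI)
  fix U :: "L2 set" assume U: "open U"
  have "Metric_space.mopen P2 W2 (quantile_L2 -` U \<inter> P2)"
    unfolding Metric_space.mopen_def[OF Metric_space_P2]
  proof safe
    fix \<mu> assume \<mu>: "\<mu> \<in> P2" "quantile_L2 \<mu> \<in> U"
    then obtain r where r: "0 < r" "ball (quantile_L2 \<mu>) r \<subseteq> U"
      using U by (meson open_contains_ball)
    show "\<exists>r>0. Metric_space.mball P2 W2 \<mu> r \<subseteq> quantile_L2 -` U \<inter> P2"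
      using r \<mu> by (intro exI[of _ r]) (auto simp: subset_iff Metric_space.in_mball[OF Metric_space_P2] W2_eq_dist)
  qed
  moreover have "sets borel_P2 = sigma_sets P2 {U. Metric_space.mopen P2 W2 U}"
    unfolding borel_P2_def by (rule sets_measure_of) (auto simp: Metric_space.mopen_def[OF Metric_space_P2])
  ultimately show "quantile_L2 -` U \<inter> space borel_P2 \<in> sets borel_P2" by simp
qed

lemma mono_cone_convex: "convex mono_cone"
proof (rule convexI)
  fix u v :: L2 and a b :: real
  assume "u \<in> mono_cone" "v \<in> mono_cone" and ab: "0 \<le> a" "0 \<le> b"
  then obtain f g where f: "sq_integrable f" "mono_on {0<..<1} f" "u = abs_L2 f"
    and g: "sq_integrable g" "mono_on {0<..<1} g" "v = abs_L2 g"
    by (auto simp: mono_cone_def)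
  have "mono_on {0<..<1} (\<lambda>x. a * f x + b * g x)"
    using ab by (intro mono_onI add_mono mult_left_mono mono_onD[OF f(2)] mono_onD[OF g(2)])
  moreover have "sq_integrable (\<lambda>x. a * f x + b * g x)"
    using f(1) g(1) by (intro sq_integrable_add sq_integrable_scale)
  moreover have "a *\<^sub>R u + b *\<^sub>R v = abs_L2 (\<lambda>x. a * f x + b * g x)"
    by (simp add: abs_L2_add abs_L2_scale sq_integrable_scale f g)
  ultimately show "a *\<^sub>R u + b *\<^sub>R v \<in> mono_cone"
    unfolding mono_cone_def by blast
qed

lemma AE_lborel01_ex:
  assumes "AE x in lborel01. P x" and ab: "0 \<le> a" "a < b" "b \<le> 1"
  shows "\<exists>x\<in>{a<..<b}. P x"
proof (rule ccontr)
  assume neg: "\<not> (\<exists>x\<in>{a<..<b}. P x)"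
  have "AE x in lborel. x \<in> {0<..<1} \<longrightarrow> P x"
    using assms(1) unfolding lborel01_def by (subst (asm) AE_restrict_space_iff) auto
  then have "AE x in lborel. x \<notin> {a<..<b}"
    by eventually_elim (use neg ab in auto)
  then have "emeasure lborel {a<..<b} = 0"
    by (subst (asm) AE_iff_measurable[where N = "{a<..<b}"]) auto
  then show False using ab by simp
qed

lemma mono_on_AE_limit:
  fixes f :: "nat \<Rightarrow> real \<Rightarrow> real"
  assumes f: "\<And>n. mono_on {0<..<1} (f n)"
    and lim: "AE x in lborel01. (\<lambda>n. f n x) \<longlonglongrightarrow> g x"
  shows "\<exists>h. mono_on {0<..<1} h \<and> (AE x in lborel01. g x = h x)"
proof -
  define G where "G = {x\<in>{0<..<1}. (\<lambda>n. f n x) \<longlonglongrightarrow> g x}"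
  have G_ex: "\<exists>x\<in>G. a < x \<and> x < b" if ab: "0 \<le> a" "a < b" "b \<le> 1" for a b
  proof -
    obtain x where "x \<in> {a<..<b}" "(\<lambda>n. f n x) \<longlonglongrightarrow> g x"
      using AE_lborel01_ex[OF lim ab] by blast
    then show ?thesis using ab by (intro bexI[of _ x]) (auto simp: G_def)
  qed
  have G_mono: "g x \<le> g y" if "x \<in> G" "y \<in> G" "x \<le> y" for x y
  proof (rule LIMSEQ_le)
    show "(\<lambda>n. f n x) \<longlonglongrightarrow> g x" "(\<lambda>n. f n y) \<longlonglongrightarrow> g y" using that by (auto simp: G_def)
    have "f n x \<le> f n y" for n using that by (intro mono_onD[OF f]) (auto simp: G_def)
    then show "\<exists>N. \<forall>n\<ge>N. f n x \<le> f n y" by blast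
  qed
  define h where "h x = (SUP y\<in>{y\<in>G. y \<le> x}. g y)" for x
  have bdd: "bdd_above (g ` {y\<in>G. y \<le> x})" if x: "x \<in> {0<..<1}" for x
  proof -
    obtain z where "z \<in> G" "x < z" using G_ex[of x 1] x by (meson greaterThanLessThan_iff less_imp_le order_refl)
    have "g y \<le> g z" if "y \<in> G" "y \<le> x" for y
      using G_mono[OF that(1) \<open>z \<in> G\<close>] that(2) \<open>x < z\<close> by simp
    then show ?thesis by (intro bdd_aboveI[of _ "g z"]) blast
  qed
  have "mono_on {0<..<1} h"
  proof (rule mono_onI)
    fix x y :: real assume xy: "x \<in> {0<..<1}" "y \<in> {0<..<1}" "x \<le> y"
    then obtain z where "z \<in> G" "z < x" using G_ex[of 0 x] by (meson greaterThanLessThan_iff less_imp_le order_refl)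
    then have "{y \<in> G. y \<le> x} \<noteq> {}" by (auto intro: less_imp_le)
    then show "h x \<le> h y"
      unfolding h_def by (rule cSUP_subset_mono) (use xy bdd in auto)
  qed
  moreover have gh: "g x = h x" if "x \<in> G" for x
  proof -
    have "h x = g x" unfolding h_def by (rule cSup_eq_maximum) (use that G_mono in blast)+
    then show ?thesis by simp
  qed
  have "AE x in lborel01. x \<in> G"
    using lim AE_space by eventually_elim (simp add: G_def)
  then have "AE x in lborel01. g x = h x" by eventually_elim (rule gh)
  ultimately show ?thesis by blast
qed

lemma L2_tendsto_AE_subseq:
  assumes f: "\<And>n. sq_integrable (f n)" and g: "sq_integrable g"
    and lim: "(\<lambda>n. abs_L2 (f n)) \<longlonglongrightarrow> abs_L2 g"
  shows "\<exists>r. strict_mono (r :: nat \<Rightarrow> nat) \<and> (AE x in lborel01. (\<lambda>n. f (r n) x) \<longlonglongrightarrow> g x)"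
proof -
  have "(\<lambda>n. (dist (abs_L2 (f n)) (abs_L2 g))\<^sup>2) \<longlonglongrightarrow> 0\<^sup>2"
    using lim by (intro tendsto_power) (simp add: tendsto_dist_iff[symmetric])
  then have "(\<lambda>n. \<integral>x. norm ((f n x - g x)\<^sup>2) \<partial>lborel01) \<longlonglongrightarrow> 0"
    by (simp add: dist_abs_L2 f g)
  moreover have "integrable lborel01 (\<lambda>x. (f n x - g x)\<^sup>2)" for n
    using sq_integrable_diff[OF f g] by (simp add: sq_integrable_def)
  ultimately obtain r where r: "strict_mono r" "AE x in lborel01. (\<lambda>n. (f (r n) x - g x)\<^sup>2) \<longlonglongrightarrow> 0"
    using tendsto_L1_AE_subseq[of lborel01 "\<lambda>n x. (f n x - g x)\<^sup>2"] by blast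
  have conv: "a \<longlonglongrightarrow> c" if "(\<lambda>n. (a n - c)\<^sup>2) \<longlonglongrightarrow> 0" for a :: "nat \<Rightarrow> real" and c
  proof -
    have "(\<lambda>n. sqrt ((a n - c)\<^sup>2)) \<longlonglongrightarrow> sqrt 0" using that by (intro tendsto_real_sqrt)
    then have "(\<lambda>n. a n - c) \<longlonglongrightarrow> 0" by (simp add: tendsto_rabs_zero_iff)
    then show ?thesis by (simp add: LIM_zero_iff)
  qed
  have "AE x in lborel01. (\<lambda>n. f (r n) x) \<longlonglongrightarrow> g x"
    using r(2) by eventually_elim (rule conv)
  with r(1) show ?thesis by blast
qed

lemma mono_cone_closed: "closed mono_cone"
  unfolding closed_sequential_limits
proof safe
  fix u :: "nat \<Rightarrow> L2" and l assume u: "\<forall>n. u n \<in> mono_cone" and l: "u \<longlonglongrightarrow> l"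
  have "\<exists>f. sq_integrable f \<and> mono_on {0<..<1} f \<and> u n = abs_L2 f" for n
    using u by (auto simp: mono_cone_def)
  then obtain f where f: "\<And>n. sq_integrable (f n)" "\<And>n. mono_on {0<..<1} (f n)" "\<And>n. u n = abs_L2 (f n)"
    by metis
  obtain g where g: "sq_integrable g" "l = abs_L2 g" by (rule L2_cases)
  have "(\<lambda>n. abs_L2 (f n)) \<longlonglongrightarrow> abs_L2 g"
    using l unfolding f(3)[symmetric] g(2)[symmetric] .
  from L2_tendsto_AE_subseq[OF f(1) g(1) this]
  obtain r where "AE x in lborel01. (\<lambda>n. f (r n) x) \<longlonglongrightarrow> g x" by blast
  then obtain h where h: "mono_on {0<..<1} h" "AE x in lborel01. g x = h x"
    using mono_on_AE_limit[of "\<lambda>n. f (r n)" g] f(2) by blast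
  have "AE x in lborel01. \<bar>h x\<bar> \<le> \<bar>g x\<bar>" using h(2) by eventually_elim simp
  then have hs: "sq_integrable h"
    by (rule sq_integrable_bound[OF mono_on_lborel01_measurable[OF h(1)] g(1)])
  have "l = abs_L2 h" using h(2) by (simp add: g abs_L2_eq_iff hs)
  with h hs show "l \<in> mono_cone" unfolding mono_cone_def by blast
qed

lemma mono_cone_nonempty: "mono_cone \<noteq> {}"
proof -
  have "abs_L2 (\<lambda>x. 0) \<in> mono_cone"
    unfolding mono_cone_def by (auto intro!: exI[of _ "\<lambda>x. 0"] sq_integrable_const mono_onI)
  then show ?thesis by blast
qed

section \<open>Nearest points in closed convex sets\<close>

lemma nearest_point_exists:
  fixes S :: "'a::{real_inner, complete_space} set"
  assumes S: "convex S" "closed S" "S \<noteq> {}"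
  shows "\<exists>y\<in>S. \<forall>z\<in>S. dist x y \<le> dist x z"
proof -
  define D where "D = (INF z\<in>S. (dist x z)\<^sup>2)"
  have bdd: "bdd_below ((\<lambda>z. (dist x z)\<^sup>2) ` S)" by (auto intro!: bdd_belowI[of _ 0])
  have D_le: "D \<le> (dist x z)\<^sup>2" if "z \<in> S" for z
    unfolding D_def using bdd that by (rule cINF_lower)
  have "\<exists>z\<in>S. (dist x z)\<^sup>2 < D + 1 / Suc n" for n
    using cINF_less_iff[OF S(3) bdd, of "D + 1 / Suc n"] by (simp add: D_def)
  then obtain y where y: "\<And>n. y n \<in> S" "\<And>n. (dist x (y n))\<^sup>2 < D + 1 / Suc n" by metis
  have "(\<lambda>n. D + 1 / real (Suc n)) \<longlonglongrightarrow> D + 0"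
    using LIMSEQ_inverse_real_of_nat unfolding inverse_eq_divide by (intro tendsto_add tendsto_const)
  then have upper: "(\<lambda>n. D + 1 / real (Suc n)) \<longlonglongrightarrow> D" by simp
  have lim: "(\<lambda>n. (dist x (y n))\<^sup>2) \<longlonglongrightarrow> D"
    by (rule tendsto_sandwich[OF _ _ tendsto_const upper])
      (use D_le[OF y(1)] less_imp_le[OF y(2)] in \<open>auto intro: always_eventually\<close>)
  have para: "(dist u v)\<^sup>2 \<le> 2 * (dist x u)\<^sup>2 + 2 * (dist x v)\<^sup>2 - 4 * D" if "u \<in> S" "v \<in> S" for u v
  proof -
    have "(1/2) *\<^sub>R u + (1/2) *\<^sub>R v \<in> S"
      using convexD[OF S(1) that, of "1/2" "1/2"] by simp
    then have "4 * D \<le> 4 * (dist x ((1/2) *\<^sub>R u + (1/2) *\<^sub>R v))\<^sup>2" using D_le by simp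
    also have "\<dots> = 2 * (dist x u)\<^sup>2 + 2 * (dist x v)\<^sup>2 - (dist u v)\<^sup>2"
      by (simp add: dist_norm power2_norm_eq_inner inner_commute algebra_simps)
    finally show ?thesis by simp
  qed
  have "Cauchy y"
  proof (rule metric_CauchyI)
    fix e :: real assume e: "0 < e"
    then have "D < D + e\<^sup>2 / 4" by simp
    from order_tendstoD(2)[OF lim this] obtain N where N: "\<And>n. N \<le> n \<Longrightarrow> (dist x (y n))\<^sup>2 < D + e\<^sup>2 / 4"
      by (auto simp: eventually_sequentially)
    have "dist (y m) (y n) < e" if "N \<le> m" "N \<le> n" for m n
    proof (rule power2_less_imp_less)
      show "(dist (y m) (y n))\<^sup>2 < e\<^sup>2"
        using para[OF y(1)[of m] y(1)[of n]] N[OF that(1)] N[OF that(2)] by linarith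
    qed (use e in simp)
    then show "\<exists>M. \<forall>m\<ge>M. \<forall>n\<ge>M. dist (y m) (y n) < e" by blast
  qed
  then obtain l where l: "y \<longlonglongrightarrow> l" using Cauchy_convergent unfolding convergent_def by blast
  have "l \<in> S" using closed_sequentially[OF S(2) y(1) l] .
  moreover have "(\<lambda>n. (dist x (y n))\<^sup>2) \<longlonglongrightarrow> (dist x l)\<^sup>2" using l by (intro tendsto_intros)
  then have "(dist x l)\<^sup>2 = D" using lim by (rule LIMSEQ_unique)
  then have "(dist x l)\<^sup>2 \<le> (dist x z)\<^sup>2" if "z \<in> S" for z
    using D_le[OF that] by simp
  then have "dist x l \<le> dist x z" if "z \<in> S" for z
    using that by (blast intro: power2_le_imp_le zero_le_dist)
  ultimately show ?thesis by blast
qed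

lemma nearest_point_unique:
  fixes S :: "'a::real_inner set"
  assumes S: "convex S"
    and y: "y \<in> S" "\<forall>z\<in>S. dist x y \<le> dist x z" and y': "y' \<in> S" "\<forall>z\<in>S. dist x y' \<le> dist x z"
  shows "y = y'"
proof -
  have "(1/2) *\<^sub>R y + (1/2) *\<^sub>R y' \<in> S"
    using convexD[OF S y(1) y'(1), of "1/2" "1/2"] by simp
  then have "(dist x y)\<^sup>2 \<le> (dist x ((1/2) *\<^sub>R y + (1/2) *\<^sub>R y'))\<^sup>2"
    using y by (intro power_mono) auto
  moreover have "4 * (dist x ((1/2) *\<^sub>R y + (1/2) *\<^sub>R y'))\<^sup>2 = 2 * (dist x y)\<^sup>2 + 2 * (dist x y')\<^sup>2 - (dist y y')\<^sup>2"
    by (simp add: dist_norm power2_norm_eq_inner inner_commute algebra_simps)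
  moreover have "dist x y' = dist x y" using y y' by (intro antisym) auto
  then have "(dist x y')\<^sup>2 = (dist x y)\<^sup>2" by simp
  ultimately have "(dist y y')\<^sup>2 \<le> 0" by linarith
  then show ?thesis by simp
qed

lemma metric_projection_eq_iff:
  fixes S :: "'a::{real_inner, complete_space} set"
  assumes S: "convex S" "closed S" "S \<noteq> {}"
  shows "y = metric_projection S x \<longleftrightarrow> y \<in> S \<and> (\<forall>z\<in>S. dist x y \<le> dist x z)"
proof -
  obtain p where p: "p \<in> S" "\<forall>z\<in>S. dist x p \<le> dist x z"
    using nearest_point_exists[OF S] by blast
  have uniq: "z = p" if "z \<in> S \<and> (\<forall>w\<in>S. dist x z \<le> dist x w)" for z
    by (rule nearest_point_unique[OF S(1) conjunct1[OF that] conjunct2[OF that] p])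
  have eq: "metric_projection S x = p"
    unfolding metric_projection_def
  proof (rule the_equality)
    show "p \<in> S \<and> (\<forall>z\<in>S. dist x p \<le> dist x z)" using p by (rule conjI)
  qed (rule uniq)
  show ?thesis
    unfolding eq
  proof
    assume "y = p"
    with p show "y \<in> S \<and> (\<forall>z\<in>S. dist x y \<le> dist x z)" by simp
  qed (rule uniq)
qed

section \<open>Integration against a signed measure\<close>

lemma nn_integral_signed_parts_le:
  "(\<integral>\<^sup>+x. f x \<partial>pos_measure M \<Lambda>) \<le> (\<integral>\<^sup>+x. f x \<partial>abs_measure M \<Lambda>)"
  "(\<integral>\<^sup>+x. f x \<partial>neg_measure M \<Lambda>) \<le> (\<integral>\<^sup>+x. f x \<partial>abs_measure M \<Lambda>)"
  by (intro nn_integral_mono_measure; simp add: le_measure emeasure_abs_measure)+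

lemma integrable_signed_parts:
  fixes f :: "'a \<Rightarrow> 'b::{banach, second_countable_topology}"
  assumes "integrable (abs_measure M \<Lambda>) f"
  shows "integrable (pos_measure M \<Lambda>) f" "integrable (neg_measure M \<Lambda>) f"
proof -
  have m: "f \<in> borel_measurable M"
    using borel_measurable_integrable[OF assms] by (simp cong: measurable_cong_sets)
  have fin: "(\<integral>\<^sup>+x. norm (f x) \<partial>abs_measure M \<Lambda>) < \<infinity>"
    using assms unfolding integrable_iff_bounded by (rule conjunct2)
  have mp: "f \<in> borel_measurable (pos_measure M \<Lambda>)" and mn: "f \<in> borel_measurable (neg_measure M \<Lambda>)"
    using m by (simp_all cong: measurable_cong_sets)
  show "integrable (pos_measure M \<Lambda>) f"
    unfolding integrable_iff_bounded
    by (rule conjI[OF mp order.strict_trans1[OF nn_integral_signed_parts_le(1) fin]])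
  show "integrable (neg_measure M \<Lambda>) f"
    unfolding integrable_iff_bounded
    by (rule conjI[OF mn order.strict_trans1[OF nn_integral_signed_parts_le(2) fin]])
qed

lemma signed_integral_const:
  assumes L: "signed_measure M \<Lambda>"
  shows "signed_integral M \<Lambda> (\<lambda>x. c) = \<Lambda> (space M) *\<^sub>R c"
  by (simp add: signed_integral_def signed_measure_Jordan[OF L] scaleR_diff_left)

lemma signed_integral_add:
  assumes "integrable (abs_measure M \<Lambda>) f" "integrable (abs_measure M \<Lambda>) g"
  shows "signed_integral M \<Lambda> (\<lambda>x. f x + g x) = signed_integral M \<Lambda> f + signed_integral M \<Lambda> g"
  using assms[THEN integrable_signed_parts(1)] assms[THEN integrable_signed_parts(2)]
  by (simp add: signed_integral_def)

lemma signed_integral_inner_right: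
  fixes f :: "'a \<Rightarrow> 'b::{banach, second_countable_topology, real_inner}"
  assumes "integrable (abs_measure M \<Lambda>) f"
  shows "signed_integral M \<Lambda> (\<lambda>x. inner c (f x)) = inner c (signed_integral M \<Lambda> f)"
  using integrable_signed_parts[OF assms] by (simp add: signed_integral_def inner_diff_right)


section \<open>The barycenter\<close>

theorem theorem1p3:
  fixes \<Lambda> :: "real measure set \<Rightarrow> real"
  assumes "signed_measure borel_P2 \<Lambda>"
    and "\<Lambda> P2 = 1"
    and "(\<integral>\<^sup>+\<nu>. ennreal (second_moment \<nu>) \<partial>abs_measure borel_P2 \<Lambda>) < \<infinity>"
  shows "(\<forall>\<mu>\<in>P2. integrable (abs_measure borel_P2 \<Lambda>) (\<lambda>\<nu>. (W2 \<mu> \<nu>)\<^sup>2)) \<and>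
    integrable (abs_measure borel_P2 \<Lambda>) quantile_L2 \<and>
    (\<exists>!\<mu>. is_arg_min (W2_functional \<Lambda>) (\<lambda>\<mu>. \<mu> \<in> P2) \<mu>) \<and>
    (\<forall>\<mu>\<in>P2. is_arg_min (W2_functional \<Lambda>) (\<lambda>\<mu>. \<mu> \<in> P2) \<mu> \<longleftrightarrow>
       quantile_L2 \<mu> = metric_projection mono_cone (signed_integral borel_P2 \<Lambda> quantile_L2))"
proof -
  note L = assms(1)
  let ?A = "abs_measure borel_P2 \<Lambda>"
  define B where "B = signed_integral borel_P2 \<Lambda> quantile_L2"
  interpret A: finite_measure ?A by (rule finite_measure_signed_parts[OF L])
  have q: "quantile_L2 \<in> borel_measurable ?A"
    using quantile_L2_measurable by (simp cong: measurable_cong_sets)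
  note [measurable] = q
  have sq: "integrable ?A (\<lambda>\<nu>. (norm (quantile_L2 \<nu>))\<^sup>2)"
  proof (rule integrableI_nonneg)
    have "(\<integral>\<^sup>+\<nu>. ennreal ((norm (quantile_L2 \<nu>))\<^sup>2) \<partial>?A) = (\<integral>\<^sup>+\<nu>. ennreal (second_moment \<nu>) \<partial>?A)"
      by (intro nn_integral_cong) (simp add: second_moment_eq_norm)
    then show "(\<integral>\<^sup>+\<nu>. ennreal ((norm (quantile_L2 \<nu>))\<^sup>2) \<partial>?A) < \<infinity>" using assms(3) by simp
  qed auto
  have int: "integrable ?A quantile_L2"
  proof (rule Bochner_Integration.integrable_bound)
    show "integrable ?A (\<lambda>\<nu>. 1 + (norm (quantile_L2 \<nu>))\<^sup>2)" using sq by simp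
    have "t \<le> 1 + t\<^sup>2" for t :: real
      using zero_le_power2[of "t - 1/2"] by (simp add: power2_diff field_simps)
    then show "AE \<nu> in ?A. norm (quantile_L2 \<nu>) \<le> norm (1 + (norm (quantile_L2 \<nu>))\<^sup>2)"
      by (simp add: abs_of_nonneg)
  qed (rule q)
  have expand: "(W2 \<mu> \<nu>)\<^sup>2 = ((norm (quantile_L2 \<mu>))\<^sup>2 + inner (-2 *\<^sub>R quantile_L2 \<mu>) (quantile_L2 \<nu>)) +
      (norm (quantile_L2 \<nu>))\<^sup>2" if "\<mu> \<in> P2" "\<nu> \<in> P2" for \<mu> \<nu>
    using that by (simp add: W2_eq_dist dist_norm power2_norm_eq_inner inner_commute algebra_simps)
  have intW: "integrable ?A (\<lambda>\<nu>. (W2 \<mu> \<nu>)\<^sup>2)" if "\<mu> \<in> P2" for \<mu>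
    using that sq int by (subst Bochner_Integration.integrable_cong[OF refl expand]) auto
  define C where "C = signed_integral borel_P2 \<Lambda> (\<lambda>\<nu>. (norm (quantile_L2 \<nu>))\<^sup>2) - (norm B)\<^sup>2"
  have W2_functional: "W2_functional \<Lambda> \<mu> = (dist B (quantile_L2 \<mu>))\<^sup>2 + C" if \<mu>: "\<mu> \<in> P2" for \<mu>
  proof -
    have i: "integrable ?A (\<lambda>\<nu>. (norm (quantile_L2 \<mu>))\<^sup>2)"
      "integrable ?A (\<lambda>\<nu>. inner (-2 *\<^sub>R quantile_L2 \<mu>) (quantile_L2 \<nu>))"
      using int by (simp, blast intro: integrable_inner_right)
    have "W2_functional \<Lambda> \<mu> = signed_integral borel_P2 \<Lambda> (\<lambda>\<nu>.
        ((norm (quantile_L2 \<mu>))\<^sup>2 + inner (-2 *\<^sub>R quantile_L2 \<mu>) (quantile_L2 \<nu>)) + (norm (quantile_L2 \<nu>))\<^sup>2)"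
      unfolding W2_functional_def signed_integral_def
      by (intro arg_cong2[where f = minus] Bochner_Integration.integral_cong refl expand \<mu>) auto
    also have "\<dots> = (norm (quantile_L2 \<mu>))\<^sup>2 + inner (-2 *\<^sub>R quantile_L2 \<mu>) B +
        signed_integral borel_P2 \<Lambda> (\<lambda>\<nu>. (norm (quantile_L2 \<nu>))\<^sup>2)"
      unfolding B_def
      by (simp only: signed_integral_add[OF Bochner_Integration.integrable_add[OF i] sq] signed_integral_add[OF i]
          signed_integral_const[OF L] signed_integral_inner_right[OF int] space_borel_P2 assms(2) scaleR_one)
    also have "\<dots> = (dist B (quantile_L2 \<mu>))\<^sup>2 + C"
      by (simp add: C_def dist_norm power2_norm_eq_inner inner_commute algebra_simps)
    finally show ?thesis .
  qed
  note proj = metric_projection_eq_iff[OF mono_cone_convex mono_cone_closed mono_cone_nonempty]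
  have iff: "is_arg_min (W2_functional \<Lambda>) (\<lambda>\<mu>. \<mu> \<in> P2) \<mu> \<longleftrightarrow>
      quantile_L2 \<mu> = metric_projection mono_cone B" if \<mu>: "\<mu> \<in> P2" for \<mu>
    unfolding proj unfolding quantile_L2_image[symmetric] is_arg_min_linorder
    using \<mu> by (auto simp: W2_functional)
  have "metric_projection mono_cone B \<in> quantile_L2 ` P2"
    unfolding quantile_L2_image using proj by blast
  then obtain \<mu> where \<mu>: "\<mu> \<in> P2" "quantile_L2 \<mu> = metric_projection mono_cone B" by force
  have ex1: "\<exists>!\<mu>. is_arg_min (W2_functional \<Lambda>) (\<lambda>\<mu>. \<mu> \<in> P2) \<mu>"
  proof (rule ex1I)
    show "is_arg_min (W2_functional \<Lambda>) (\<lambda>\<mu>. \<mu> \<in> P2) \<mu>" using iff \<mu> by blast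
    fix \<nu> assume \<nu>: "is_arg_min (W2_functional \<Lambda>) (\<lambda>\<mu>. \<mu> \<in> P2) \<nu>"
    then have "\<nu> \<in> P2" by (simp add: is_arg_min_def)
    with \<nu> \<mu> show "\<nu> = \<mu>"
      using iff[OF \<open>\<nu> \<in> P2\<close>] quantile_L2_eq_iff[OF \<open>\<nu> \<in> P2\<close> \<mu>(1)] by simp
  qed
  show ?thesis
    by (intro conjI ballI intW int ex1 iff[unfolded B_def])
qed

end
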